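(* Let $\alpha\in(0,1)$ and suppose that Assumption A (stated in the context) holds for every $h\in\mathcal{H}$. Let $\lambda=\{f(g(\theta_0)|\theta_0)\nabla_\theta g(\theta_0)\}^{-1}$, let $Y_{(1)}=\min\{Y_1,\ldots,Y_n\}$, and define the test $$\phi_n(Y^n)=\begin{cases}1 & \text{if } Y_{(1)}>g\left(\theta_0+\frac{\lambda}{n}\log\frac1\alpha\right)\text{ or } Y_{(1)}<g(\theta_0),\\ 0 & \text{if } g(\theta_0)\le Y_{(1)}\le g\left(\theta_0+\frac{\lambda}{n}\log\frac1\alpha\right).\end{cases}$$ Then $\{\phi_n(Y^n)\}$ is asymptotically uniformly most powerful (AUMP) in $\mathcal{H}$ at asymptotic level $\alpha$ for testing $H_0:h=0$ against $H_1:h\ne0$. That is, $\limsup_n E_{\theta_0}[\phi_n]\le\alpha$, and for every other sequence of tests $\{\psi_n\}$ satisfying $\limsup_n E_{\theta_0}[\psi_n]\le\alpha$, $$\liminf_n E_{\theta_0+h/n}[\phi_n]\ \ge\ \limsup_n E_{\theta_0+h/n}[\psi_n]\quad\text{for every } h\neq0 \text{ in } \mathcal{H}.$$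
   Context: Model. A scalar random variable $Y\in\mathcal{Y}\subset\mathbb{R}$ has Lebesgue density $f(y|\theta)\mathbb{I}\{y\ge g(\theta)\}$, where $\theta\in\Theta\subset\mathbb{R}$ is a scalar parameter and $\mathbb{I}\{\cdot\}$ is the indicator function. Fix $\theta_0\in\Theta$ and reparametrize locally by $h=n(\theta-\theta_0)\in\mathcal{H}\subset\mathbb{R}$. One observes an i.i.d. sample $Y^n=(Y_1,\ldots,Y_n)$ of $Y$. $P_{\theta_0+h/n}$ and $E_{\theta_0+h/n}$ denote probability and expectation when $Y_1,\dots,Y_n$ are i.i.d. from the density with $\theta=\theta_0+h/n$ ($n$ large enough that $\theta_0+h/n\in\Theta$). A test is a measurable function of $Y^n$ with values in $[0,1]$, interpreted as the probability of rejecting the null. Assumption A. (i) $\{Y_i\}_{i=1}^n$ is an i.i.d. sample of $Y$ with the Lebesgue density $f(y|\theta)\mathbb{I}\{y\ge g(\theta)\}$. $\Theta$ is convex, $\theta_0\in\mathrm{int}(\Theta)$, and $0\in\mathcal{H}$. (ii) $f(y|\theta)$ is twice continuously differentiable in $\theta$ for all $y$. In some open neighborhood $\mathcal{N}$ of $\theta_0$: $f(y|\theta)$ and $\nabla_\theta f(y|\theta)$ are continuous in $y$ for $\theta\in\mathcal{N}$; there is a constant $C$ such that $0<f(y|\theta)<C<\infty$ and $|\nabla_\theta f(y|\theta)|<C<\infty$ for all $y$ and $\theta\in\mathcal{N}$; and $$\int\sup_{\theta\in\mathcal{N}}\|\nabla_\theta f(y|\theta)\|\,\mathbb{I}\{y\ge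 g(\theta)\}\,dy<\infty,$$ $$\int\sup_{\theta,\bar\theta\in\mathcal{N}}\frac{\|\nabla_\theta f(y|\bar\theta)\|^2}{f(y|\bar\theta)^2}\mathbb{I}\{y\ge g(\theta)\}f(y|\theta)\,dy<\infty,$$ $$\int\sup_{\theta,\bar\theta\in\mathcal{N}}\frac{\|\nabla_{\theta\theta} f(y|\bar\theta)\|}{f(y|\bar\theta)}\mathbb{I}\{y\ge g(\theta)\}f(y|\theta)\,dy<\infty.$$ $g(\theta)$ is continuously differentiable in $\theta$, $\nabla_\theta g(\theta_0)>0$, and $\sup_{\theta\in\mathcal{N}}\|\nabla_\theta g(\theta)\|<\infty$. *)

theory Defs
  imports "HOL-Probability.Probability"
begin

text \<open>
  The density of one observation is \<open>f(y|\<theta>) I{y \<ge> g(\<theta>)}\<close> on the sample space \<open>Y\<close>, a Borel subset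
  of the reals, and zero off \<open>Y\<close>. So \<open>f y \<theta>\<close> is only meaningful for \<open>y \<in> Y\<close> and \<open>\<theta> \<in> \<Theta>\<close>.
\<close>

definition obs_density ::
  "real set \<Rightarrow> (real \<Rightarrow> real \<Rightarrow> real) \<Rightarrow> (real \<Rightarrow> real) \<Rightarrow> real \<Rightarrow> real \<Rightarrow> real" where
  "obs_density Y f g \<theta> y = f y \<theta> * indicator {y \<in> Y. g \<theta> \<le> y} y"

definition obs_law ::
  "real set \<Rightarrow> (real \<Rightarrow> real \<Rightarrow> real) \<Rightarrow> (real \<Rightarrow> real) \<Rightarrow> real \<Rightarrow> real measure" where
  "obs_law Y f g \<theta> = density lborel (\<lambda>y. ennreal (obs_density Y f g \<theta> y))"

definition sample_law ::
  "real set \<Rightarrow> (real \<Rightarrow> real \<Rightarrow> real) \<Rightarrow> (real \<Rightarrow> real) \<Rightarrow> real \<Rightarrow> nat \<Rightarrow> (nat \<Rightarrow> real) measure" where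
  "sample_law Y f g \<theta> n = PiM {1..n} (\<lambda>_. obs_law Y f g \<theta>)"

text \<open>
  \<open>Df\<close> and \<open>DDf\<close> stand for the first and second \<open>\<theta>\<close>-derivative of \<open>f\<close>, and \<open>Dg\<close> for the derivative
  of \<open>g\<close>. The suprema are taken in \<open>ennreal\<close>, over the whole integrand including the indicator
  \<open>I{y \<ge> g(\<theta>)}\<close>.
\<close>

definition regular_on ::
  "real set \<Rightarrow> real set \<Rightarrow> (real \<Rightarrow> real \<Rightarrow> real) \<Rightarrow> (real \<Rightarrow> real \<Rightarrow> real) \<Rightarrow> (real \<Rightarrow> real \<Rightarrow> real)
    \<Rightarrow> (real \<Rightarrow> real) \<Rightarrow> (real \<Rightarrow> real) \<Rightarrow> bool" where
  "regular_on N Y f Df DDf g Dg \<longleftrightarrow>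
     (\<forall>\<theta>\<in>N. g \<theta> \<in> Y) \<and>
     (\<forall>\<theta>\<in>N. continuous_on Y (\<lambda>y. f y \<theta>) \<and> continuous_on Y (\<lambda>y. Df y \<theta>)) \<and>
     (\<exists>C. \<forall>y\<in>Y. \<forall>\<theta>\<in>N. 0 < f y \<theta> \<and> f y \<theta> < C \<and> \<bar>Df y \<theta>\<bar> < C) \<and>
     (\<integral>\<^sup>+y\<in>Y. (SUP \<theta>\<in>N. ennreal (\<bar>Df y \<theta>\<bar> * indicator {g \<theta>..} y)) \<partial>lborel) < \<infinity> \<and>
     (\<integral>\<^sup>+y\<in>Y. (SUP \<theta>\<in>N. SUP \<theta>'\<in>N.
        ennreal (\<bar>Df y \<theta>'\<bar>\<^sup>2 / (f y \<theta>')\<^sup>2 * indicator {g \<theta>..} y * f y \<theta>)) \<partial>lborel) < \<infinity> \<and>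
     (\<integral>\<^sup>+y\<in>Y. (SUP \<theta>\<in>N. SUP \<theta>'\<in>N.
        ennreal (\<bar>DDf y \<theta>'\<bar> / f y \<theta>' * indicator {g \<theta>..} y * f y \<theta>)) \<partial>lborel) < \<infinity> \<and>
     (\<exists>K. \<forall>\<theta>\<in>N. \<bar>Dg \<theta>\<bar> \<le> K)"

text \<open>
  The condition \<open>g \<theta> \<in> Y\<close> in \<open>regular_on\<close> makes \<open>f(g(\<theta>)|\<theta>)\<close> meaningful near \<open>\<theta>\<^sub>0\<close>; it is void
  for \<open>Y = UNIV\<close>. Derivatives are taken within \<open>\<Theta>\<close>, which is a nondegenerate interval, so they are
  unique and one-sided at its endpoints.
\<close>

locale assumption_A =
  fixes Y :: "real set" and \<Theta> :: "real set" and \<theta>\<^sub>0 :: real and H :: "real set"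
    and f Df DDf :: "real \<Rightarrow> real \<Rightarrow> real" and g Dg :: "real \<Rightarrow> real"
  assumes Y_borel: "Y \<in> sets borel"
    and density_measurable: "\<And>\<theta>. \<theta> \<in> \<Theta> \<Longrightarrow> obs_density Y f g \<theta> \<in> borel_measurable borel"
    and density_nonneg: "\<And>\<theta> y. \<theta> \<in> \<Theta> \<Longrightarrow> 0 \<le> obs_density Y f g \<theta> y"
    and density_prob: "\<And>\<theta>. \<theta> \<in> \<Theta> \<Longrightarrow> prob_space (obs_law Y f g \<theta>)"
    and convex_Theta: "convex \<Theta>"
    and theta0_interior: "\<theta>\<^sub>0 \<in> interior \<Theta>"
    and zero_in_H: "0 \<in> H"
    and f_deriv: "\<And>y \<theta>. y \<in> Y \<Longrightarrow> \<theta> \<in> \<Theta> \<Longrightarrow>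
          ((\<lambda>t. f y t) has_real_derivative Df y \<theta>) (at \<theta> within \<Theta>)"
    and Df_deriv: "\<And>y \<theta>. y \<in> Y \<Longrightarrow> \<theta> \<in> \<Theta> \<Longrightarrow>
          ((\<lambda>t. Df y t) has_real_derivative DDf y \<theta>) (at \<theta> within \<Theta>)"
    and DDf_cont: "\<And>y. y \<in> Y \<Longrightarrow> continuous_on \<Theta> (\<lambda>t. DDf y t)"
    and g_deriv: "\<And>\<theta>. \<theta> \<in> \<Theta> \<Longrightarrow> (g has_real_derivative Dg \<theta>) (at \<theta> within \<Theta>)"
    and Dg_cont: "continuous_on \<Theta> Dg"
    and Dg_pos: "0 < Dg \<theta>\<^sub>0"
    and regular: "\<exists>N. open N \<and> \<theta>\<^sub>0 \<in> N \<and> N \<subseteq> \<Theta> \<and> regular_on N Y f Df DDf g Dg"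

definition is_test_seq :: "(nat \<Rightarrow> (nat \<Rightarrow> real) \<Rightarrow> real) \<Rightarrow> bool" where
  "is_test_seq \<psi> \<longleftrightarrow> (\<forall>n. \<psi> n \<in> borel_measurable (PiM {1..n} (\<lambda>_. borel)) \<and>
     (\<forall>y \<in> space (PiM {1..n} (\<lambda>_. borel)). \<psi> n y \<in> {0..1}))"

text \<open>
  \<open>Q h n\<close> is the law of the sample of size \<open>n\<close> under the local parameter \<open>h\<close>; the null is \<open>h = 0\<close>.
  Limits superior and inferior are taken in \<open>ereal\<close>.
\<close>

definition asymptotic_level ::
  "(real \<Rightarrow> nat \<Rightarrow> (nat \<Rightarrow> real) measure) \<Rightarrow> real \<Rightarrow> (nat \<Rightarrow> (nat \<Rightarrow> real) \<Rightarrow> real) \<Rightarrow> bool" where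
  "asymptotic_level Q \<alpha> \<psi> \<longleftrightarrow> limsup (\<lambda>n. ereal (\<integral>y. \<psi> n y \<partial>Q 0 n)) \<le> ereal \<alpha>"

definition AUMP ::
  "(real \<Rightarrow> nat \<Rightarrow> (nat \<Rightarrow> real) measure) \<Rightarrow> real set \<Rightarrow> real \<Rightarrow> (nat \<Rightarrow> (nat \<Rightarrow> real) \<Rightarrow> real) \<Rightarrow> bool" where
  "AUMP Q H \<alpha> \<phi> \<longleftrightarrow> is_test_seq \<phi> \<and> asymptotic_level Q \<alpha> \<phi> \<and>
     (\<forall>\<psi>. is_test_seq \<psi> \<and> asymptotic_level Q \<alpha> \<psi> \<longrightarrow>
       (\<forall>h\<in>H. h \<noteq> 0 \<longrightarrow>
          limsup (\<lambda>n. ereal (\<integral>y. \<psi> n y \<partial>Q h n)) \<le> liminf (\<lambda>n. ereal (\<integral>y. \<phi> n y \<partial>Q h n))))"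

definition min_test :: "(real \<Rightarrow> real) \<Rightarrow> real \<Rightarrow> real \<Rightarrow> real \<Rightarrow> nat \<Rightarrow> (nat \<Rightarrow> real) \<Rightarrow> real" where
  "min_test g \<theta>\<^sub>0 lam \<alpha> n y =
     (let y1 = Min (y ` {1..n}) in
      if y1 > g (\<theta>\<^sub>0 + lam / real n * ln (1 / \<alpha>)) \<or> y1 < g \<theta>\<^sub>0 then 1 else 0)"

end

theory Submission
  imports Defs
begin

text \<open>
  Write \<open>\<theta>\<^sub>h = \<theta>\<^sub>0 + h / n\<close> and \<open>\<kappa> = 1 / \<lambda> = f(g(\<theta>\<^sub>0)|\<theta>\<^sub>0) g'(\<theta>\<^sub>0)\<close>. Locally the model looks like a single
  observation from a shifted exponential distribution with rate \<open>\<kappa>\<close>, in which the minimum carries all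
  the information. The proof separates the two ways in which the law of the sample depends on \<open>h\<close>.

  The boundary. Near \<open>g(\<theta>\<^sub>0)\<close> the density is almost constant, and \<open>g\<close> is almost linear near \<open>\<theta>\<^sub>0\<close>, so
  \<open>n P\<^sub>h(Y < g(\<theta>\<^sub>0 + b/n))\<close> tends to \<open>\<kappa> max(0, b - h)\<close> (\<open>mass_below_cutoff\<close>). Hence all \<open>n\<close>
  observations exceed \<open>g(\<theta>\<^sub>0 + b/n)\<close> with probability tending to \<open>exp(-\<kappa> max(0, b - h))\<close>
  (\<open>survival_tendsto\<close>). This gives the limiting power of the minimum test,
  \<open>1 - exp(-\<kappa> max(0, -h)) + exp(-\<kappa> max(0, c - h))\<close> with \<open>c = \<lambda> ln(1/\<alpha>)\<close>, which is \<open>\<alpha>\<close> at \<open>h = 0\<close>.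

  The interior. Restrict both densities, at \<open>\<theta>\<^sub>0\<close> and at \<open>\<theta>\<^sub>h\<close>, to the common support
  \<open>y \<ge> max(g(\<theta>\<^sub>0), g(\<theta>\<^sub>h))\<close>, where they retain the masses \<open>a\<close> and \<open>b\<close>. There they are smooth in the
  parameter, and the integrability of \<open>(\<nabla>f)\<^sup>2 / f\<close> bounds their squared Hellinger distance by
  \<open>O(1/n\<^sup>2)\<close> (\<open>hellinger_bound\<close>). Hellinger affinities multiply over independent observations, so the
  \<open>n\<close>-fold products, normalised to mass one, are at squared distance \<open>O(1/n)\<close>: no test tells them apart
  in the limit. Thus a test of level \<open>\<alpha>\<close> has power at most \<open>(b/a)\<^sup>n \<alpha> + o(1)\<close> on the common support
  (\<open>product_test_hellinger_bound\<close>, \<open>test_power_bound\<close>), and \<open>(b/a)\<^sup>n\<close> tends to \<open>exp(\<kappa> h)\<close> by the boundary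
  limits.

  Off the common support the test can at best always reject, with probability tending to
  \<open>1 - exp(-\<kappa> max(0, -h))\<close>. The sum of the two bounds is the power of the minimum test when \<open>h < c\<close>. When
  \<open>h \<ge> c > 0\<close> that power tends to one and there is nothing to beat.
\<close>

section \<open>Powers and products of densities\<close>

lemma power_tendsto_exp:
  fixes p :: "nat \<Rightarrow> real"
  assumes "(\<lambda>n. real n * p n) \<longlonglongrightarrow> x"
  shows "(\<lambda>n. (1 - p n) ^ n) \<longlonglongrightarrow> exp (- x)"
proof -
  have "(\<lambda>n. inverse (real n) * (real n * p n)) \<longlonglongrightarrow> 0 * x"
    by (intro tendsto_mult lim_inverse_n assms)
  moreover have "eventually (\<lambda>n. inverse (real n) * (real n * p n) = p n) sequentially"
    using eventually_gt_at_top[of 0] by eventually_elim simp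
  ultimately have p0: "p \<longlonglongrightarrow> 0"
    by (simp add: tendsto_cong)
  then have small: "eventually (\<lambda>n. p n < 1) sequentially"
    by (rule order_tendstoD) simp
  have "(\<lambda>n. real n * ln (1 - p n)) \<longlonglongrightarrow> - x"
  proof (rule tendsto_sandwich)
    show "(\<lambda>n. - ((real n * p n) / (1 - p n))) \<longlonglongrightarrow> - x"
      using tendsto_minus[OF tendsto_divide[OF assms tendsto_diff[OF tendsto_const[of 1] p0]]] by simp
    show "(\<lambda>n. - (real n * p n)) \<longlonglongrightarrow> - x"
      using assms by (intro tendsto_intros)
    show "\<forall>\<^sub>F n in sequentially. - ((real n * p n) / (1 - p n)) \<le> real n * ln (1 - p n)"
      using small
    proof eventually_elim
      case (elim n)
      have "ln (1 / (1 - p n)) \<le> 1 / (1 - p n) - 1"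
        using elim by (intro ln_le_minus_one) simp
      also have "\<dots> = p n / (1 - p n)"
        using elim by (simp add: field_simps)
      finally have "- (p n / (1 - p n)) \<le> ln (1 - p n)"
        using elim by (simp add: ln_div)
      from mult_left_mono[OF this, of "real n"] show ?case by simp
    qed
    show "\<forall>\<^sub>F n in sequentially. real n * ln (1 - p n) \<le> - (real n * p n)"
      using small
    proof eventually_elim
      case (elim n)
      have "ln (1 - p n) \<le> - p n"
        using elim ln_le_minus_one[of "1 - p n"] by simp
      from mult_left_mono[OF this, of "real n"] show ?case by simp
    qed
  qed
  then have "(\<lambda>n. exp (real n * ln (1 - p n))) \<longlonglongrightarrow> exp (- x)"
    by (rule tendsto_exp)
  moreover have "eventually (\<lambda>n. exp (real n * ln (1 - p n)) = (1 - p n) ^ n) sequentially"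
    using small by eventually_elim (simp add: exp_of_nat_mult)
  ultimately show ?thesis
    by (simp add: tendsto_cong)
qed

text \<open>
  Both sides agree on boxes, because the integral of a product of functions of separate coordinates
  factorises.
\<close>

lemma PiM_density:
  fixes p :: "'a \<Rightarrow> real"
  assumes "finite I" and "sigma_finite_measure M" and "sigma_finite_measure (density M p)"
    and [measurable]: "p \<in> borel_measurable M" and nonneg: "\<And>x. 0 \<le> p x"
  shows "PiM I (\<lambda>_. density M p) = density (PiM I (\<lambda>_. M)) (\<lambda>x. \<Prod>i\<in>I. p (x i))"
proof -
  interpret M: sigma_finite_measure M by fact
  interpret P: sigma_finite_measure "density M p" by fact
  interpret PM: product_sigma_finite "\<lambda>_. M" by standard
  interpret PP: product_sigma_finite "\<lambda>_. density M p" by standard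
  note [measurable] = \<open>finite I\<close>
  show ?thesis
  proof (rule PP.PiM_eqI[symmetric])
    show "sets (density (PiM I (\<lambda>_. M)) (\<lambda>x. \<Prod>i\<in>I. p (x i))) = sets (PiM I (\<lambda>_. density M p))"
      by (simp cong: sets_PiM_cong)
  next
    fix A assume "\<And>i. i \<in> I \<Longrightarrow> A i \<in> sets (density M p)"
    then have A[measurable]: "\<And>i. i \<in> I \<Longrightarrow> A i \<in> sets M" by simp
    have "emeasure (density (PiM I (\<lambda>_. M)) (\<lambda>x. \<Prod>i\<in>I. p (x i))) (PiE I A)
        = (\<integral>\<^sup>+x. ennreal (\<Prod>i\<in>I. p (x i)) * indicator (PiE I A) x \<partial>PiM I (\<lambda>_. M))"
      using assms by (subst emeasure_density) auto
    also have "\<dots> = (\<integral>\<^sup>+x. (\<Prod>i\<in>I. ennreal (p (x i)) * indicator (A i) (x i)) \<partial>PiM I (\<lambda>_. M))"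
    proof (rule nn_integral_cong)
      fix x assume "x \<in> space (PiM I (\<lambda>_. M))"
      then have "indicator (PiE I A) x = (\<Prod>i\<in>I. indicator (A i) (x i) :: ennreal)"
        using \<open>finite I\<close> by (auto simp: indicator_def space_PiM PiE_iff prod_zero_iff intro!: prod_zero)
      then show "ennreal (\<Prod>i\<in>I. p (x i)) * indicator (PiE I A) x
          = (\<Prod>i\<in>I. ennreal (p (x i)) * indicator (A i) (x i))"
        by (simp add: prod.distrib prod_ennreal nonneg)
    qed
    also have "\<dots> = (\<Prod>i\<in>I. \<integral>\<^sup>+x. ennreal (p x) * indicator (A i) x \<partial>M)"
      using assms by (intro PM.product_nn_integral_prod) auto
    also have "\<dots> = (\<Prod>i\<in>I. emeasure (density M p) (A i))"
      by (intro prod.cong refl) (simp add: emeasure_density)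
    finally show "emeasure (density (PiM I (\<lambda>_. M)) (\<lambda>x. \<Prod>i\<in>I. p (x i))) (PiE I A)
        = (\<Prod>i\<in>I. emeasure (density M p) (A i))" .
  qed fact
qed

text \<open>
  The term \<open>q + p - 2 * sqrt (p * q)\<close> is \<open>(sqrt q - sqrt p)\<^sup>2\<close>, and the inequality is the square of
  \<open>sqrt q = sqrt p + (sqrt q - sqrt p)\<close> with the cross term absorbed by weights \<open>\<epsilon>\<close> and \<open>1 / \<epsilon>\<close>. It is
  stated with the mixed term expanded because that form integrates over a product measure factor by
  factor.
\<close>

lemma le_hellinger_split:
  fixes p q \<epsilon> :: real
  assumes "0 \<le> p" "0 \<le> q" "0 < \<epsilon>"
  shows "q \<le> (1 + \<epsilon>) * p + (1 + 1 / \<epsilon>) * (q + p - 2 * sqrt (p * q))"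
proof -
  define s t where "s = sqrt p" and "t = sqrt q"
  have p: "p = s\<^sup>2" and q: "q = t\<^sup>2"
    using assms by (simp_all add: s_def t_def)
  have "0 \<le> (\<epsilon> * s - (t - s))\<^sup>2 / \<epsilon>"
    using assms by simp
  also have "\<dots> = (1 + \<epsilon>) * s\<^sup>2 + (1 + 1 / \<epsilon>) * (t - s)\<^sup>2 - t\<^sup>2"
    using assms by (simp add: field_simps power2_eq_square)
  finally have "t\<^sup>2 \<le> (1 + \<epsilon>) * s\<^sup>2 + (1 + 1 / \<epsilon>) * (t - s)\<^sup>2"
    by simp
  moreover have "(t - s)\<^sup>2 = q + p - 2 * sqrt (p * q)"
    using assms by (simp add: s_def t_def power2_diff real_sqrt_mult)
  ultimately show ?thesis by (simp only: p[symmetric] q[symmetric])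
qed

text \<open>
  Two one-observation densities with masses \<open>a\<close> and \<open>b\<close> that are close in Hellinger distance cannot be
  separated by a test on few observations, beyond the difference in mass: rescale the first density to
  mass \<open>b\<close>, apply \<open>le_hellinger_split\<close> to the product densities pointwise and integrate. The affinity of
  the products is the power of the one-observation affinity, so Bernoulli's inequality makes the error
  linear in the number of observations. As long as that number times the squared distance is small, so
  is the error.
\<close>

lemma product_test_hellinger_bound:
  fixes p q :: "'a \<Rightarrow> real" and \<psi> :: "('i \<Rightarrow> 'a) \<Rightarrow> real"
  assumes "sigma_finite_measure M" and I: "finite I"
    and p: "integrable M p" "\<And>x. 0 \<le> p x" and q: "integrable M q" "\<And>x. 0 \<le> q x"
    and a: "a = (\<integral>x. p x \<partial>M)" "0 < a" and b: "b = (\<integral>x. q x \<partial>M)" "0 < b"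
    and \<psi>[measurable]: "\<psi> \<in> borel_measurable (PiM I (\<lambda>_. M))"
    and \<psi>01: "\<And>x. x \<in> space (PiM I (\<lambda>_. M)) \<Longrightarrow> \<psi> x \<in> {0..1}"
    and \<epsilon>: "0 < \<epsilon>"
  shows "(\<integral>x. \<psi> x * (\<Prod>i\<in>I. q (x i)) \<partial>PiM I (\<lambda>_. M))
     \<le> (1 + \<epsilon>) * (b / a) ^ card I * (\<integral>x. \<psi> x * (\<Prod>i\<in>I. p (x i)) \<partial>PiM I (\<lambda>_. M))
       + (1 + 1 / \<epsilon>) * (b ^ card I * (card I * (\<integral>x. (sqrt (q x) - sqrt (p x))\<^sup>2 \<partial>M) / sqrt (a * b)))"
    (is "?lhs \<le> ?rhs")
proof -
  interpret M: sigma_finite_measure M by fact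
  interpret PM: product_sigma_finite "\<lambda>_. M" by standard
  let ?PM = "PiM I (\<lambda>_. M)" and ?n = "card I"
  have [measurable]: "p \<in> borel_measurable M" "q \<in> borel_measurable M"
    using p q by auto
  define B where "B = (\<integral>x. sqrt (p x * q x) \<partial>M)"
  define H2 where "H2 = (\<integral>x. (sqrt (q x) - sqrt (p x))\<^sup>2 \<partial>M)"
  have sqrt_int: "integrable M (\<lambda>x. sqrt (p x * q x))"
  proof (rule Bochner_Integration.integrable_bound)
    show "integrable M (\<lambda>x. p x + q x)"
      using p q by simp
    show "AE x in M. norm (sqrt (p x * q x)) \<le> norm (p x + q x)"
    proof (rule AE_I2)
      fix x
      have "sqrt (p x * q x) \<le> (p x + q x) / 2"
        by (rule arith_geo_mean_sqrt[OF p(2) q(2)])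
      then show "norm (sqrt (p x * q x)) \<le> norm (p x + q x)"
        using p(2)[of x] q(2)[of x] by simp
    qed
  qed simp
  have H2: "H2 = a + b - 2 * B"
  proof -
    have "(sqrt (q x) - sqrt (p x))\<^sup>2 = p x + q x - 2 * sqrt (p x * q x)" for x
      using p(2) q(2) by (simp add: power2_diff real_sqrt_mult)
    then have "H2 = (\<integral>x. p x + q x - 2 * sqrt (p x * q x) \<partial>M)"
      by (simp add: H2_def)
    also have "\<dots> = a + b - 2 * B"
      using p q sqrt_int by (simp add: a b B_def)
    finally show ?thesis .
  qed
  \<comment> \<open>scaling \<open>p\<close> by \<open>c\<close> gives both products the same mass \<open>b ^ card I\<close>\<close>
  define c where "c = b / a"
  have c: "0 < c" using a b by (simp add: c_def)
  define P Q where "P x = c ^ ?n * (\<Prod>i\<in>I. p (x i))" and "Q x = (\<Prod>i\<in>I. q (x i))" for x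
  have P0: "0 \<le> P x" and Q0: "0 \<le> Q x" for x
    using c p q by (auto simp: P_def Q_def intro!: mult_nonneg_nonneg prod_nonneg)
  have P_int: "integrable ?PM P" and Q_int: "integrable ?PM Q"
    using p q I unfolding P_def Q_def
    by (auto intro!: integrable_mult_right PM.product_integrable_prod)
  have bn: "(\<integral>x. P x \<partial>?PM) = b ^ ?n" "(\<integral>x. Q x \<partial>?PM) = b ^ ?n"
  proof -
    have "(\<integral>x. P x \<partial>?PM) = c ^ ?n * a ^ ?n"
      using PM.product_integral_prod[OF I, of "\<lambda>_. p"] p(1) by (simp add: P_def a(1))
    also have "\<dots> = b ^ ?n"
      using a(2) by (simp add: c_def flip: power_mult_distrib)
    finally show "(\<integral>x. P x \<partial>?PM) = b ^ ?n" .
    show "(\<integral>x. Q x \<partial>?PM) = b ^ ?n"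
      using PM.product_integral_prod[OF I, of "\<lambda>_. q"] q(1) by (simp add: Q_def b(1))
  qed
  have sqrt_PQ: "sqrt (P x * Q x) = sqrt c ^ ?n * (\<Prod>i\<in>I. sqrt (p (x i) * q (x i)))" for x
  proof -
    have "sqrt (\<Prod>i\<in>J. p (x i) * q (x i)) = (\<Prod>i\<in>J. sqrt (p (x i) * q (x i)))" for J
      by (induction J rule: infinite_finite_induct) (simp_all add: real_sqrt_mult)
    moreover have "P x * Q x = c ^ ?n * (\<Prod>i\<in>I. p (x i) * q (x i))"
      by (simp add: P_def Q_def prod.distrib)
    ultimately show ?thesis
      by (simp only: real_sqrt_mult real_sqrt_power)
  qed
  have PQ_int: "integrable ?PM (\<lambda>x. sqrt (P x * Q x))"
    unfolding sqrt_PQ using I sqrt_int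
    by (intro integrable_mult_right PM.product_integrable_prod) auto
  have PQ: "(\<integral>x. sqrt (P x * Q x) \<partial>?PM) = (sqrt c * B) ^ ?n"
    using PM.product_integral_prod[OF I, of "\<lambda>_ x. sqrt (p x * q x)"] sqrt_int
    by (simp add: sqrt_PQ B_def power_mult_distrib)
  have H2_0: "0 \<le> H2" and B0: "0 \<le> B"
    by (auto simp: H2_def B_def p q)
  have sc: "sqrt c * sqrt (a * b) = b"
    using a b by (simp add: c_def flip: real_sqrt_mult)
  have affinity: "2 * b ^ ?n - 2 * (sqrt c * B) ^ ?n \<le> b ^ ?n * (?n * H2 / sqrt (a * b))"
  proof -
    \<comment> \<open>one minus the affinity of the two densities after both are normalised to mass one\<close>
    define u where "u = 1 - B / sqrt (a * b)"
    have ab: "0 < sqrt (a * b)" using a b by simp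
    have "0 \<le> (sqrt a - sqrt b)\<^sup>2" by simp
    then have amgm: "2 * sqrt (a * b) \<le> a + b"
      using a(2) b(2) by (simp add: power2_diff real_sqrt_mult)
    have u: "2 * u \<le> H2 / sqrt (a * b)"
    proof -
      have "2 * u = (2 * sqrt (a * b) - 2 * B) / sqrt (a * b)"
        using a(2) b(2) by (simp add: u_def diff_divide_distrib)
      also have "\<dots> \<le> H2 / sqrt (a * b)"
        using ab amgm by (intro divide_right_mono) (simp_all add: H2)
      finally show ?thesis .
    qed
    have "1 + real ?n * (- u) \<le> (1 + (- u)) ^ ?n"
      using ab B0 by (intro Bernoulli_inequality) (simp add: u_def)
    moreover have "(sqrt c * B) ^ ?n = b ^ ?n * (1 + (- u)) ^ ?n"
    proof -
      have "sqrt c * B = b * (1 + (- u))"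
      proof -
        have "b * (1 + (- u)) = (sqrt c * sqrt (a * b)) * (B / sqrt (a * b))"
          by (simp add: sc u_def)
        then show ?thesis using a(2) b(2) by simp
      qed
      then show ?thesis by (simp add: power_mult_distrib)
    qed
    ultimately have "2 * b ^ ?n - 2 * (sqrt c * B) ^ ?n \<le> 2 * b ^ ?n - 2 * (b ^ ?n * (1 + real ?n * (- u)))"
      using b(2) by simp
    also have "\<dots> = b ^ ?n * (?n * (2 * u))" by (simp add: algebra_simps)
    also have "\<dots> \<le> b ^ ?n * (?n * (H2 / sqrt (a * b)))"
      using u b(2) by (intro mult_left_mono) auto
    finally show ?thesis by simp
  qed
  have bdd: "integrable ?PM (\<lambda>x. \<psi> x * F x)" if "integrable ?PM F" for F :: "('i \<Rightarrow> 'a) \<Rightarrow> real"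
    using that
  proof (rule Bochner_Integration.integrable_bound)
    show "AE x in ?PM. norm (\<psi> x * F x) \<le> norm (F x)"
      using \<psi>01 by (intro AE_I2) (auto simp: abs_mult mult_left_le_one_le)
    show "(\<lambda>x. \<psi> x * F x) \<in> borel_measurable ?PM"
      using that by measurable
  qed
  have "?lhs = (\<integral>x. \<psi> x * Q x \<partial>?PM)" by (simp add: Q_def)
  also have "\<dots> \<le> (\<integral>x. (1 + \<epsilon>) * (\<psi> x * P x) + (1 + 1 / \<epsilon>) * (Q x + P x - 2 * sqrt (P x * Q x)) \<partial>?PM)"
  proof (intro integral_mono bdd Q_int)
    show "integrable ?PM (\<lambda>x. (1 + \<epsilon>) * (\<psi> x * P x) + (1 + 1 / \<epsilon>) * (Q x + P x - 2 * sqrt (P x * Q x)))"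
      using bdd[OF P_int] P_int Q_int PQ_int by auto
    fix x assume x: "x \<in> space ?PM"
    let ?r = "(1 + 1 / \<epsilon>) * (Q x + P x - 2 * sqrt (P x * Q x))"
    have "0 \<le> (sqrt (Q x) - sqrt (P x))\<^sup>2" by simp
    then have "0 \<le> Q x + P x - 2 * sqrt (P x * Q x)"
      using P0[of x] Q0[of x] by (simp add: power2_diff real_sqrt_mult algebra_simps)
    then have "0 \<le> ?r"
      using \<epsilon> by (intro mult_nonneg_nonneg) auto
    then have "\<psi> x * ?r \<le> ?r"
      using \<psi>01[OF x] by (simp add: mult_left_le_one_le)
    moreover have "\<psi> x * Q x \<le> \<psi> x * ((1 + \<epsilon>) * P x + ?r)"
      using \<psi>01[OF x] le_hellinger_split[OF P0 Q0 \<epsilon>] by (intro mult_left_mono) auto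
    ultimately show "\<psi> x * Q x \<le> (1 + \<epsilon>) * (\<psi> x * P x) + ?r"
      by (simp add: distrib_left mult.left_commute)
  qed
  also have "\<dots> = (1 + \<epsilon>) * (\<integral>x. \<psi> x * P x \<partial>?PM) + (1 + 1 / \<epsilon>) * (2 * b ^ ?n - 2 * (sqrt c * B) ^ ?n)"
    using bdd[OF P_int] P_int Q_int PQ_int by (simp add: bn PQ)
  also have "(\<integral>x. \<psi> x * P x \<partial>?PM) = c ^ ?n * (\<integral>x. \<psi> x * (\<Prod>i\<in>I. p (x i)) \<partial>?PM)"
    unfolding P_def mult.left_commute[of "\<psi> _"] by (rule integral_mult_right_zero)
  finally have "?lhs \<le> (1 + \<epsilon>) * (c ^ ?n * (\<integral>x. \<psi> x * (\<Prod>i\<in>I. p (x i)) \<partial>?PM))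
      + (1 + 1 / \<epsilon>) * (2 * b ^ ?n - 2 * (sqrt c * B) ^ ?n)" .
  also have "\<dots> \<le> (1 + \<epsilon>) * (c ^ ?n * (\<integral>x. \<psi> x * (\<Prod>i\<in>I. p (x i)) \<partial>?PM))
      + (1 + 1 / \<epsilon>) * (b ^ ?n * (?n * H2 / sqrt (a * b)))"
    using \<epsilon> by (intro add_left_mono mult_left_mono affinity) auto
  finally show ?thesis
    by (simp only: c_def H2_def mult.assoc)
qed

section \<open>A neighbourhood of the null parameter\<close>

text \<open>
  A closed interval around \<open>\<theta>\<^sub>0\<close> on which the regularity conditions hold in the form in which they are
  used. On it \<open>g\<close> is increasing, so a support that contains the supports at two parameters contains those
  in between. A neighbourhood of the boundary point \<open>g \<theta>\<^sub>0\<close> lies in the sample space, so near that point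
  the density is positive and, at the null parameter, continuous. The information integral is the condition on the squared score,
  restricted to equal parameters in numerator and weight.
\<close>

locale regular_neighbourhood = assumption_A +
  fixes I :: "real set" and \<delta> C K :: real
  assumes I_def: "I = {\<theta>\<^sub>0 - \<delta>..\<theta>\<^sub>0 + \<delta>}"
    and delta_pos: "0 < \<delta>"
    and I_subset: "I \<subseteq> \<Theta>"
    and f_DERIV: "\<And>y \<theta>. y \<in> Y \<Longrightarrow> \<theta> \<in> I \<Longrightarrow> (f y has_real_derivative Df y \<theta>) (at \<theta>)"
    and f_pos: "\<And>y \<theta>. y \<in> Y \<Longrightarrow> \<theta> \<in> I \<Longrightarrow> 0 < f y \<theta>"
    and Df_bounded: "\<And>y \<theta>. y \<in> Y \<Longrightarrow> \<theta> \<in> I \<Longrightarrow> \<bar>Df y \<theta>\<bar> \<le> C"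
    and f_cont: "continuous_on Y (\<lambda>y. f y \<theta>\<^sub>0)"
    and g_DERIV: "(g has_real_derivative Dg \<theta>\<^sub>0) (at \<theta>\<^sub>0)"
    and g_mono: "strict_mono_on I g"
    and g_range: "{g (\<theta>\<^sub>0 - \<delta>)..g (\<theta>\<^sub>0 + \<delta>)} \<subseteq> Y"
    and information: "(\<integral>\<^sup>+y\<in>Y. (SUP \<theta>\<in>I. ennreal ((Df y \<theta>)\<^sup>2 / f y \<theta> * indicator {g \<theta>..} y)) \<partial>lborel)
          \<le> ennreal K"
    and K_nonneg: "0 \<le> K"

text \<open>
  Since \<open>Dg\<close> is continuous and positive at \<open>\<theta>\<^sub>0\<close>, \<open>g\<close> increases strictly nearby; by the intermediate
  value theorem every value between \<open>g (\<theta>\<^sub>0 - \<delta>)\<close> and \<open>g (\<theta>\<^sub>0 + \<delta>)\<close> is some \<open>g \<theta>\<close>, hence in \<open>Y\<close>.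
\<close>

lemma (in assumption_A) obtain_regular_neighbourhood:
  obtains I \<delta> C K where "regular_neighbourhood Y \<Theta> \<theta>\<^sub>0 H f Df DDf g Dg I \<delta> C K"
proof -
  obtain N where N: "open N" "\<theta>\<^sub>0 \<in> N" "N \<subseteq> \<Theta>" and reg: "regular_on N Y f Df DDf g Dg"
    using regular by blast
  have at_N: "at \<theta> within \<Theta> = at \<theta>" if "\<theta> \<in> N" for \<theta>
    using N that by (intro at_within_interior) (meson interior_maximal subsetD)
  have f_D: "(f y has_real_derivative Df y \<theta>) (at \<theta>)" if "y \<in> Y" "\<theta> \<in> N" for y \<theta>
    using f_deriv[of y \<theta>] that N at_N[of \<theta>] by auto
  have g_D: "(g has_real_derivative Dg \<theta>) (at \<theta>)" if "\<theta> \<in> N" for \<theta>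
    using g_deriv[of \<theta>] that N at_N[of \<theta>] by auto
  have "continuous_on N Dg"
    using Dg_cont N continuous_on_subset by blast
  then have "isCont Dg \<theta>\<^sub>0"
    using N continuous_on_eq_continuous_at by blast
  then have "eventually (\<lambda>t. 0 < Dg t) (nhds \<theta>\<^sub>0)"
    using Dg_pos by (auto simp: isCont_def tendsto_at_iff_tendsto_nhds dest: order_tendstoD)
  moreover have "eventually (\<lambda>t. t \<in> N) (nhds \<theta>\<^sub>0)"
    using N by (auto simp: eventually_nhds)
  ultimately have "eventually (\<lambda>t. 0 < Dg t \<and> t \<in> N) (nhds \<theta>\<^sub>0)"
    by eventually_elim simp
  then obtain d where d: "0 < d" "\<And>t. dist t \<theta>\<^sub>0 < d \<Longrightarrow> 0 < Dg t \<and> t \<in> N"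
    by (auto simp: eventually_nhds_metric)
  define \<delta> where "\<delta> = d / 2"
  define I where "I = {\<theta>\<^sub>0 - \<delta>..\<theta>\<^sub>0 + \<delta>}"
  have I: "0 < Dg t" "t \<in> N" if "t \<in> I" for t
    using d(1) d(2)[of t] that by (auto simp: I_def \<delta>_def dist_real_def abs_if field_simps)
  have delta: "0 < \<delta>" using d(1) by (simp add: \<delta>_def)
  have mono: "strict_mono_on I g"
  proof (rule strict_mono_onI)
    fix r s assume rs: "r \<in> I" "s \<in> I" "r < s"
    have sub: "t \<in> I" if "r \<le> t" "t \<le> s" for t
      using rs that by (auto simp: I_def)
    show "g r < g s"
      using rs(3) by (rule DERIV_pos_imp_increasing) (use sub I g_D in blast)
  qed
  have range: "{g (\<theta>\<^sub>0 - \<delta>)..g (\<theta>\<^sub>0 + \<delta>)} \<subseteq> Y"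
  proof
    fix y assume y: "y \<in> {g (\<theta>\<^sub>0 - \<delta>)..g (\<theta>\<^sub>0 + \<delta>)}"
    have "\<exists>x\<ge>\<theta>\<^sub>0 - \<delta>. x \<le> \<theta>\<^sub>0 + \<delta> \<and> g x = y"
      using y delta by (intro IVT) (auto simp: I_def intro!: DERIV_isCont g_D I)
    then obtain x where "x \<in> I" "g x = y" by (auto simp: I_def)
    then show "y \<in> Y" using I reg by (auto simp: regular_on_def)
  qed
  obtain C where C: "\<And>y \<theta>. y \<in> Y \<Longrightarrow> \<theta> \<in> N \<Longrightarrow> 0 < f y \<theta> \<and> f y \<theta> < C \<and> \<bar>Df y \<theta>\<bar> < C"
    using reg unfolding regular_on_def by blast
  let ?J = "\<integral>\<^sup>+y\<in>Y. (SUP \<theta>\<in>I. ennreal ((Df y \<theta>)\<^sup>2 / f y \<theta> * indicator {g \<theta>..} y)) \<partial>lborel"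
  have "?J \<le> (\<integral>\<^sup>+y\<in>Y. (SUP \<theta>\<in>N. SUP \<theta>'\<in>N.
        ennreal (\<bar>Df y \<theta>'\<bar>\<^sup>2 / (f y \<theta>')\<^sup>2 * indicator {g \<theta>..} y * f y \<theta>)) \<partial>lborel)"
  proof (rule nn_integral_mono)
    fix y :: real
    show "(SUP \<theta>\<in>I. ennreal ((Df y \<theta>)\<^sup>2 / f y \<theta> * indicator {g \<theta>..} y)) * indicator Y y
      \<le> (SUP \<theta>\<in>N. SUP \<theta>'\<in>N.
        ennreal (\<bar>Df y \<theta>'\<bar>\<^sup>2 / (f y \<theta>')\<^sup>2 * indicator {g \<theta>..} y * f y \<theta>)) * indicator Y y"
    proof (cases "y \<in> Y")
      case True
      have "ennreal ((Df y \<theta>)\<^sup>2 / f y \<theta> * indicator {g \<theta>..} y)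
        \<le> (SUP \<theta>\<in>N. SUP \<theta>'\<in>N. ennreal (\<bar>Df y \<theta>'\<bar>\<^sup>2 / (f y \<theta>')\<^sup>2 * indicator {g \<theta>..} y * f y \<theta>))"
        if "\<theta> \<in> I" for \<theta>
      proof -
        have "(Df y \<theta>)\<^sup>2 / f y \<theta> * indicator {g \<theta>..} y
          = \<bar>Df y \<theta>\<bar>\<^sup>2 / (f y \<theta>)\<^sup>2 * indicator {g \<theta>..} y * f y \<theta>"
          using C[OF True I(2)[OF that]] by (simp add: power2_eq_square)
        then show ?thesis
          using I(2)[OF that] by (simp only:) (intro SUP_upper2[of \<theta>] order_refl)
      qed
      then show ?thesis
        using True by (simp add: SUP_least)
    qed simp
  qed
  also have "\<dots> < \<infinity>" using reg by (simp add: regular_on_def)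
  finally have "?J < \<infinity>" .
  then have J: "?J \<le> ennreal (enn2real ?J)"
    by (simp add: less_top)
  have "regular_neighbourhood Y \<Theta> \<theta>\<^sub>0 H f Df DDf g Dg I \<delta> C (enn2real ?J)"
  proof
    show "I = {\<theta>\<^sub>0 - \<delta>..\<theta>\<^sub>0 + \<delta>}" by (fact I_def)
    show "0 < \<delta>" by (fact delta)
    show "I \<subseteq> \<Theta>" using I N by blast
    show "(f y has_real_derivative Df y \<theta>) (at \<theta>)" if "y \<in> Y" "\<theta> \<in> I" for y \<theta>
      using that I f_D by blast
    show "0 < f y \<theta>" if "y \<in> Y" "\<theta> \<in> I" for y \<theta>
      using that I C by blast
    show "\<bar>Df y \<theta>\<bar> \<le> C" if "y \<in> Y" "\<theta> \<in> I" for y \<theta>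
      using that I C by (meson less_imp_le)
    show "continuous_on Y (\<lambda>y. f y \<theta>\<^sub>0)"
      using reg N by (simp add: regular_on_def)
    show "(g has_real_derivative Dg \<theta>\<^sub>0) (at \<theta>\<^sub>0)" using N g_D by blast
    show "strict_mono_on I g" by (fact mono)
    show "{g (\<theta>\<^sub>0 - \<delta>)..g (\<theta>\<^sub>0 + \<delta>)} \<subseteq> Y" by (fact range)
    show "?J \<le> ennreal (enn2real ?J)" by (fact J)
  qed simp
  then show ?thesis by (rule that)
qed

section \<open>The law of the sample\<close>

context assumption_A
begin

abbreviation density_at :: "real \<Rightarrow> real \<Rightarrow> real" where
  "density_at \<equiv> obs_density Y f g"

abbreviation law :: "real \<Rightarrow> real measure" where
  "law \<equiv> obs_law Y f g"

text \<open>
  A second name, since interpreting \<open>prob_space\<close> inside a proof hides the first one.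
\<close>

lemmas density_at_nonneg = density_nonneg

lemma sets_law [measurable_cong]: "sets (law \<theta>) = sets borel"
  by (simp add: obs_law_def)

lemma space_law [simp]: "space (law \<theta>) = UNIV"
  by (simp add: obs_law_def)

lemma density_integrable:
  assumes "\<theta> \<in> \<Theta>" shows "integrable lborel (density_at \<theta>)"
    and "(\<integral>y. density_at \<theta> y \<partial>lborel) = 1"
proof -
  interpret prob_space "law \<theta>" by (rule density_prob[OF assms])
  have [measurable]: "density_at \<theta> \<in> borel_measurable borel"
    by (rule density_measurable[OF assms])
  have "(\<integral>\<^sup>+y. ennreal (density_at \<theta> y) \<partial>lborel) = emeasure (law \<theta>) UNIV"
    by (simp add: obs_law_def emeasure_density)
  also have "\<dots> = 1" using emeasure_space_1 by simp
  finally have *: "(\<integral>\<^sup>+y. ennreal (density_at \<theta> y) \<partial>lborel) = 1" .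
  then show "integrable lborel (density_at \<theta>)"
    using density_at_nonneg[OF assms] by (intro integrableI_nonneg) auto
  show "(\<integral>y. density_at \<theta> y \<partial>lborel) = 1"
    using * density_at_nonneg[OF assms] by (subst integral_eq_nn_integral) auto
qed

lemma measure_law:
  assumes "\<theta> \<in> \<Theta>" and [measurable]: "B \<in> sets borel"
  shows "measure (law \<theta>) B = (\<integral>y. density_at \<theta> y * indicator B y \<partial>lborel)"
proof -
  have [measurable]: "density_at \<theta> \<in> borel_measurable borel"
    by (rule density_measurable[OF assms(1)])
  have "emeasure (law \<theta>) B = (\<integral>\<^sup>+y. ennreal (density_at \<theta> y * indicator B y) \<partial>lborel)"
    using density_at_nonneg[OF assms(1)]
    by (simp add: obs_law_def emeasure_density ennreal_mult' ennreal_indicator)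
  then show ?thesis
    using density_at_nonneg[OF assms(1)] by (subst integral_eq_nn_integral) (auto simp: measure_def)
qed

lemma measure_law_greaterThan:
  assumes "\<theta> \<in> \<Theta>"
  shows "measure (law \<theta>) {t<..} = measure (law \<theta>) {t..}"
proof -
  have [measurable]: "density_at \<theta> \<in> borel_measurable borel"
    by (rule density_measurable[OF assms])
  have "(\<integral>y. density_at \<theta> y * indicator {t<..} y \<partial>lborel)
      = (\<integral>y. density_at \<theta> y * indicator {t..} y \<partial>lborel)"
  proof (rule integral_cong_AE)
    show "AE y in lborel. density_at \<theta> y * indicator {t<..} y = density_at \<theta> y * indicator {t..} y"
      using AE_lborel_singleton[of t] by eventually_elim (auto simp: indicator_def)
  qed measurable
  then show ?thesis by (simp add: measure_law assms)
qed

lemma measure_law_atLeast_support: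
  assumes "\<theta> \<in> \<Theta>"
  shows "measure (law \<theta>) {max s (g \<theta>)..} = measure (law \<theta>) {s..}"
    and "measure (law \<theta>) {max (g \<theta>) s..} = measure (law \<theta>) {s..}"
proof -
  have "density_at \<theta> y * indicator {max s (g \<theta>)..} y = density_at \<theta> y * indicator {s..} y" for y
    by (auto simp: obs_density_def indicator_def)
  then show *: "measure (law \<theta>) {max s (g \<theta>)..} = measure (law \<theta>) {s..}"
    by (simp only: measure_law[OF assms] atLeast_borel)
  then show "measure (law \<theta>) {max (g \<theta>) s..} = measure (law \<theta>) {s..}"
    by (simp add: max.commute)
qed

lemma sample_law_all_in:
  assumes "\<theta> \<in> \<Theta>" and [measurable]: "B \<in> sets borel"
  shows "integrable (sample_law Y f g \<theta> n) (\<lambda>y. \<Prod>i\<in>{1..n}. indicator B (y i) :: real)"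
    and "(\<integral>y. (\<Prod>i\<in>{1..n}. indicator B (y i)) \<partial>sample_law Y f g \<theta> n) = measure (law \<theta>) B ^ n"
proof -
  interpret prob_space "law \<theta>" by (rule density_prob[OF assms(1)])
  interpret product_sigma_finite "\<lambda>_::nat. law \<theta>" by standard
  have int: "integrable (law \<theta>) (indicator B :: real \<Rightarrow> real)"
    by (simp add: sets_law emeasure_eq_measure)
  show "integrable (sample_law Y f g \<theta> n) (\<lambda>y. \<Prod>i\<in>{1..n}. indicator B (y i) :: real)"
    unfolding sample_law_def using int by (intro product_integrable_prod) auto
  show "(\<integral>y. (\<Prod>i\<in>{1..n}. indicator B (y i)) \<partial>sample_law Y f g \<theta> n) = measure (law \<theta>) B ^ n"
    unfolding sample_law_def
    using product_integral_prod[of "{1..n}" "\<lambda>_. indicator B :: real \<Rightarrow> real"] int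
    by (simp add: sets_law)
qed

lemma sample_law_density:
  assumes "\<theta> \<in> \<Theta>"
  shows "sample_law Y f g \<theta> n = density (PiM {1..n} (\<lambda>_. lborel)) (\<lambda>y. \<Prod>i\<in>{1..n}. density_at \<theta> (y i))"
  unfolding sample_law_def obs_law_def
proof (rule PiM_density)
  interpret prob_space "law \<theta>" by (rule density_prob[OF assms])
  show "sigma_finite_measure (density lborel (\<lambda>y. ennreal (density_at \<theta> y)))"
    unfolding obs_law_def[symmetric] by unfold_locales
  show "density_at \<theta> \<in> borel_measurable lborel" "0 \<le> density_at \<theta> y" for y
    using assms density_measurable density_at_nonneg by auto
qed (auto intro: lborel.sigma_finite_measure_axioms)

lemma integral_sample_law:
  assumes "\<theta> \<in> \<Theta>" and "\<psi> \<in> borel_measurable (PiM {1..n} (\<lambda>_. borel))"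
  shows "(\<integral>y. \<psi> y \<partial>sample_law Y f g \<theta> n)
      = (\<integral>y. \<psi> y * (\<Prod>i\<in>{1..n}. density_at \<theta> (y i)) \<partial>PiM {1..n} (\<lambda>_. lborel))"
proof -
  have [measurable]: "density_at \<theta> \<in> borel_measurable borel"
    by (rule density_measurable[OF assms(1)])
  have "(borel_measurable (PiM {1..n} (\<lambda>_. lborel)) :: ((nat \<Rightarrow> real) \<Rightarrow> real) set)
      = borel_measurable (PiM {1..n} (\<lambda>_. borel))"
    by (intro measurable_cong_sets sets_PiM_cong) auto
  with assms(2) have [measurable]: "\<psi> \<in> borel_measurable (PiM {1..n} (\<lambda>_. lborel))"
    by (simp only:)
  show ?thesis
    unfolding sample_law_density[OF assms(1)]
  proof (subst integral_density)
    show "\<psi> \<in> borel_measurable (PiM {1..n} (\<lambda>_. lborel))" by fact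
    show "(\<lambda>y. \<Prod>i\<in>{1..n}. density_at \<theta> (y i)) \<in> borel_measurable (PiM {1..n} (\<lambda>_. lborel))"
      by measurable
    show "AE y in PiM {1..n} (\<lambda>_. lborel). 0 \<le> (\<Prod>i\<in>{1..n}. density_at \<theta> (y i))"
      using density_at_nonneg[OF assms(1)] by (auto intro!: prod_nonneg)
  qed (simp only: real_scaleR_def mult.commute)
qed

text \<open>
  The test accepts exactly when all observations are at least \<open>g \<theta>\<^sub>0\<close> but not all exceed \<open>t\<close>. Both
  events are products over the sample, and the second lies in the first.
\<close>

lemma expectation_min_test:
  assumes "\<theta> \<in> \<Theta>" and "0 < n" and t: "t = g (\<theta>\<^sub>0 + lam / real n * ln (1 / \<alpha>))" "g \<theta>\<^sub>0 \<le> t"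
  shows "(\<integral>y. min_test g \<theta>\<^sub>0 lam \<alpha> n y \<partial>sample_law Y f g \<theta> n)
      = 1 - measure (law \<theta>) {g \<theta>\<^sub>0..} ^ n + measure (law \<theta>) {t..} ^ n"
proof -
  let ?ind = "\<lambda>B y. \<Prod>i\<in>{1..n}. indicator B (y i) :: real"
  have ind: "?ind B y = (if \<forall>i\<in>{1..n}. y i \<in> B then 1 else 0)" for B :: "real set" and y
    by (auto simp: prod_zero_iff indicator_def split: if_splits)
  have "min_test g \<theta>\<^sub>0 lam \<alpha> n y = 1 - ?ind {g \<theta>\<^sub>0..} y + ?ind {t<..} y" for y
  proof -
    have "g \<theta>\<^sub>0 \<le> Min (y ` {1..n}) \<longleftrightarrow> (\<forall>i\<in>{1..n}. y i \<in> {g \<theta>\<^sub>0..})"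
      and "t < Min (y ` {1..n}) \<longleftrightarrow> (\<forall>i\<in>{1..n}. y i \<in> {t<..})"
      using \<open>0 < n\<close> by auto
    then show ?thesis
      unfolding min_test_def Let_def ind t(1)[symmetric] using t(2) by (auto simp: not_less)
  qed
  moreover have "prob_space (sample_law Y f g \<theta> n)"
    unfolding sample_law_def using assms(1) by (intro prob_space_PiM density_prob)
  then have "(\<integral>y. 1 \<partial>sample_law Y f g \<theta> n) = (1::real)" "integrable (sample_law Y f g \<theta> n) (\<lambda>_. 1 :: real)"
    by (simp_all add: prob_space.prob_space prob_space_def finite_measure.integrable_const)
  ultimately show ?thesis
    using sample_law_all_in[OF assms(1), of "{g \<theta>\<^sub>0..}" n] sample_law_all_in[OF assms(1), of "{t<..}" n]
    by (simp add: measure_law_greaterThan[OF assms(1)])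
qed

end

section \<open>The boundary: sample minima at the local scale\<close>

context regular_neighbourhood
begin

lemma theta0_in_I: "\<theta>\<^sub>0 \<in> I"
  using delta_pos by (simp add: I_def)

lemma f_lipschitz:
  assumes "y \<in> Y" "\<theta> \<in> I" "\<theta>' \<in> I"
  shows "\<bar>f y \<theta> - f y \<theta>'\<bar> \<le> C * \<bar>\<theta> - \<theta>'\<bar>"
proof -
  have "norm (f y \<theta> - f y \<theta>') \<le> C * norm (\<theta> - \<theta>')"
  proof (rule field_differentiable_bound)
    show "convex I" by (simp add: I_def)
    show "(f y has_field_derivative Df y t) (at t within I)" if "t \<in> I" for t
      using f_DERIV[OF assms(1) that] by (rule has_field_derivative_at_within)
    show "norm (Df y t) \<le> C" if "t \<in> I" for t
      using Df_bounded[OF assms(1) that] by simp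
  qed fact+
  then show ?thesis by simp
qed

lemma local_parameter_tendsto: "(\<lambda>n. \<theta>\<^sub>0 + h / real n) \<longlonglongrightarrow> \<theta>\<^sub>0"
proof -
  have "(\<lambda>n. \<theta>\<^sub>0 + h * inverse (real n)) \<longlonglongrightarrow> \<theta>\<^sub>0 + h * 0"
    by (intro tendsto_intros lim_inverse_n)
  then show ?thesis by (simp add: divide_inverse)
qed

lemma eventually_in_I: "eventually (\<lambda>n. \<theta>\<^sub>0 + h / real n \<in> I) sequentially"
proof -
  have "eventually (\<lambda>n. \<theta>\<^sub>0 - \<delta> < \<theta>\<^sub>0 + h / real n \<and> \<theta>\<^sub>0 + h / real n < \<theta>\<^sub>0 + \<delta>) sequentially"
    using delta_pos
    by (intro eventually_conj order_tendstoD[OF local_parameter_tendsto]) auto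
  then show ?thesis by eventually_elim (simp add: I_def)
qed

lemma eventually_in_Theta: "eventually (\<lambda>n. \<theta>\<^sub>0 + h / real n \<in> \<Theta>) sequentially"
  using eventually_in_I[of h] by eventually_elim (use I_subset in blast)

lemma g_local_tendsto: "(\<lambda>n. g (\<theta>\<^sub>0 + h / real n)) \<longlonglongrightarrow> g \<theta>\<^sub>0"
  using DERIV_isCont[OF g_DERIV] local_parameter_tendsto by (rule isCont_tendsto_compose)

lemma g_scaled_increment:
  "(\<lambda>n. real n * (g (\<theta>\<^sub>0 + b / real n) - g \<theta>\<^sub>0)) \<longlonglongrightarrow> b * Dg \<theta>\<^sub>0"
proof (cases "b = 0")
  case False
  have lim: "filterlim (\<lambda>n. b / real n) (at 0) sequentially"
  proof (rule filterlim_atI)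
    show "(\<lambda>n. b / real n) \<longlonglongrightarrow> 0"
      using tendsto_mult_left[OF lim_inverse_n, of b] by (simp add: divide_inverse)
    show "eventually (\<lambda>n. b / real n \<noteq> 0) sequentially"
      using eventually_gt_at_top[of 0] by eventually_elim (simp add: False)
  qed
  have "((\<lambda>x. (g (\<theta>\<^sub>0 + x) - g \<theta>\<^sub>0) / x) \<longlongrightarrow> Dg \<theta>\<^sub>0) (at 0)"
    using g_DERIV by (simp add: DERIV_def)
  from tendsto_mult_left[OF filterlim_compose[OF this lim], of b]
  have "(\<lambda>n. b * ((g (\<theta>\<^sub>0 + b / real n) - g \<theta>\<^sub>0) / (b / real n))) \<longlonglongrightarrow> b * Dg \<theta>\<^sub>0" .
  moreover have "b * (x / (b / real n)) = real n * x" for x n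
    using False by simp
  ultimately show ?thesis by (simp only:)
qed simp

text \<open>
  Below \<open>t\<close> the law at \<open>\<theta>\<close> lives on the interval from \<open>g \<theta>\<close> to \<open>t\<close>; a density within \<open>e\<close> of a constant
  \<open>v\<close> there gives mass \<open>v\<close> times the length up to the error. That \<open>t\<close> is a value of \<open>g\<close> on \<open>I\<close> keeps the
  interval inside the sample space.
\<close>

lemma measure_law_lessThan_bounds:
  assumes \<theta>: "\<theta> \<in> I" and s: "s \<in> I" and gs: "g \<theta> \<le> t" "t = g s"
    and bound: "\<And>y. y \<in> Y \<Longrightarrow> g \<theta> \<le> y \<Longrightarrow> y \<le> t \<Longrightarrow> \<bar>f y \<theta> - v\<bar> \<le> e"
  shows "\<bar>measure (law \<theta>) {..<t} - v * (t - g \<theta>)\<bar> \<le> e * (t - g \<theta>)"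
proof -
  have \<theta>': "\<theta> \<in> \<Theta>" using \<theta> I_subset by blast
  have sub: "{g \<theta>..t} \<subseteq> Y"
  proof -
    have "g (\<theta>\<^sub>0 - \<delta>) \<le> g \<theta>" "g s \<le> g (\<theta>\<^sub>0 + \<delta>)"
      using \<theta> s delta_pos strict_mono_on_leD[OF g_mono] by (auto simp: I_def)
    then show ?thesis using g_range gs by (meson atLeastatMost_subset_iff order_trans)
  qed
  have dens: "density_at \<theta> y * indicator {..<t} y = f y \<theta> * indicator {g \<theta>..<t} y" for y
    using sub by (auto simp: obs_density_def indicator_def subset_iff)
  have int: "integrable lborel (\<lambda>y. f y \<theta> * indicator {g \<theta>..<t} y)"
    using integrable_mult_indicator[OF _ density_integrable(1)[OF \<theta>'], of "{..<t}"]
    by (simp add: dens[symmetric] mult.commute)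
  have const: "integrable lborel (\<lambda>y. c * indicator {g \<theta>..<t} y)"
    "(\<integral>y. c * indicator {g \<theta>..<t} y \<partial>lborel) = c * (t - g \<theta>)" for c :: real
    using gs by (auto simp: emeasure_lborel_Ico intro!: integrable_mult_right)
  have mass: "measure (law \<theta>) {..<t} = (\<integral>y. f y \<theta> * indicator {g \<theta>..<t} y \<partial>lborel)"
    by (simp add: measure_law[OF \<theta>'] dens)
  have bnd: "\<bar>f y \<theta> - v\<bar> \<le> e" if "g \<theta> \<le> y" "y < t" for y
    using bound[of y] subsetD[OF sub, of y] that by auto
  have "measure (law \<theta>) {..<t} \<le> (\<integral>y. (v + e) * indicator {g \<theta>..<t} y \<partial>lborel)"
    unfolding mass using bnd
    by (intro integral_mono int const) (fastforce simp: indicator_def abs_le_iff)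
  moreover have "(\<integral>y. (v - e) * indicator {g \<theta>..<t} y \<partial>lborel) \<le> measure (law \<theta>) {..<t}"
    unfolding mass using bnd
    by (intro integral_mono int const) (fastforce simp: indicator_def abs_le_iff)
  ultimately show ?thesis
    unfolding const by (simp add: abs_le_iff algebra_simps)
qed

abbreviation rate :: real where
  "rate \<equiv> f (g \<theta>\<^sub>0) \<theta>\<^sub>0 * Dg \<theta>\<^sub>0"

lemma rate_pos: "0 < rate"
proof -
  have "g (\<theta>\<^sub>0 - \<delta>) \<le> g \<theta>\<^sub>0" "g \<theta>\<^sub>0 \<le> g (\<theta>\<^sub>0 + \<delta>)"
    using delta_pos strict_mono_on_leD[OF g_mono] by (auto simp: I_def)
  then have "g \<theta>\<^sub>0 \<in> Y" using g_range by auto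
  then show ?thesis using f_pos theta0_in_I Dg_pos by simp
qed

text \<open>
  For \<open>b \<le> h\<close> the cutoff lies below the support and the mass is zero. Otherwise the interval between the
  boundary and the cutoff has length about \<open>(b - h) * Dg \<theta>\<^sub>0 / n\<close>, and on it \<open>f y (\<theta>\<^sub>0 + h / n)\<close> is
  uniformly close to \<open>f (g \<theta>\<^sub>0) \<theta>\<^sub>0\<close>: the change of \<open>\<theta>\<close> costs at most \<open>C * \<bar>h\<bar> / n\<close>, and the change of \<open>y\<close> is
  controlled by continuity at the null parameter only.
\<close>

lemma mass_below_cutoff:
  "(\<lambda>n. real n * measure (law (\<theta>\<^sub>0 + h / real n)) {..<g (\<theta>\<^sub>0 + b / real n)})
     \<longlonglongrightarrow> max 0 (b - h) * rate"
proof (cases "b \<le> h")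
  case True
  have "eventually (\<lambda>n. real n * measure (law (\<theta>\<^sub>0 + h / real n)) {..<g (\<theta>\<^sub>0 + b / real n)} = 0) sequentially"
    using eventually_in_I[of h] eventually_in_I[of b]
  proof eventually_elim
    case (elim n)
    have "g (\<theta>\<^sub>0 + b / real n) \<le> g (\<theta>\<^sub>0 + h / real n)"
      using elim True by (intro strict_mono_on_leD[OF g_mono]) (auto intro!: divide_right_mono)
    then have "density_at (\<theta>\<^sub>0 + h / real n) y * indicator {..<g (\<theta>\<^sub>0 + b / real n)} y = 0" for y
      by (auto simp: obs_density_def indicator_def)
    moreover have "\<theta>\<^sub>0 + h / real n \<in> \<Theta>" using elim I_subset by blast
    ultimately have "measure (law (\<theta>\<^sub>0 + h / real n)) {..<g (\<theta>\<^sub>0 + b / real n)} = 0"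
      by (simp only: measure_law lessThan_borel integral_zero)
    then show ?case by simp
  qed
  with True show ?thesis by (simp add: tendsto_eventually)
next
  case False
  define \<theta> t where "\<theta> n = \<theta>\<^sub>0 + h / real n" and "t n = g (\<theta>\<^sub>0 + b / real n)" for n
  define len where "len n = real n * (t n - g (\<theta> n))" for n
  let ?v = "f (g \<theta>\<^sub>0) \<theta>\<^sub>0"
  have len: "len \<longlonglongrightarrow> (b - h) * Dg \<theta>\<^sub>0"
    using tendsto_diff[OF g_scaled_increment[of b] g_scaled_increment[of h]]
    by (simp add: len_def[abs_def] t_def \<theta>_def algebra_simps)
  have \<theta>_t: "(\<lambda>n. g (\<theta> n)) \<longlonglongrightarrow> g \<theta>\<^sub>0" "t \<longlonglongrightarrow> g \<theta>\<^sub>0"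
    unfolding \<theta>_def[abs_def] t_def[abs_def] by (rule g_local_tendsto)+
  have "g \<theta>\<^sub>0 \<in> Y"
    using g_range delta_pos strict_mono_on_leD[OF g_mono, of "\<theta>\<^sub>0 - \<delta>" \<theta>\<^sub>0]
      strict_mono_on_leD[OF g_mono, of \<theta>\<^sub>0 "\<theta>\<^sub>0 + \<delta>"] by (auto simp: I_def)
  have approx: "eventually (\<lambda>n. \<bar>real n * measure (law (\<theta> n)) {..<t n} - ?v * len n\<bar> \<le> e * len n) sequentially"
    if "0 < e" for e
  proof -
    obtain d where d: "0 < d" "\<And>y. y \<in> Y \<Longrightarrow> dist y (g \<theta>\<^sub>0) < d \<Longrightarrow> dist (f y \<theta>\<^sub>0) ?v < e / 2"
      using f_cont \<open>g \<theta>\<^sub>0 \<in> Y\<close> \<open>0 < e\<close> unfolding continuous_on_iff by (metis half_gt_zero)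
    have "(\<lambda>n. C * \<bar>\<theta> n - \<theta>\<^sub>0\<bar>) \<longlonglongrightarrow> C * \<bar>\<theta>\<^sub>0 - \<theta>\<^sub>0\<bar>"
      unfolding \<theta>_def by (intro tendsto_intros local_parameter_tendsto)
    then have "eventually (\<lambda>n. C * \<bar>\<theta> n - \<theta>\<^sub>0\<bar> < e / 2) sequentially"
      by (rule order_tendstoD(2)) (use \<open>0 < e\<close> in simp)
    moreover have "eventually (\<lambda>n. g \<theta>\<^sub>0 - d < g (\<theta> n)) sequentially"
      by (rule order_tendstoD(1)[OF \<theta>_t(1)]) (use d in simp)
    moreover have "eventually (\<lambda>n. t n < g \<theta>\<^sub>0 + d) sequentially"
      by (rule order_tendstoD(2)[OF \<theta>_t(2)]) (use d in simp)
    ultimately show ?thesis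
      using eventually_in_I[of h] eventually_in_I[of b]
    proof eventually_elim
      case (elim n)
      have le: "g (\<theta> n) \<le> t n"
        unfolding t_def \<theta>_def
        using elim False by (intro strict_mono_on_leD[OF g_mono]) (auto intro!: divide_right_mono)
      have "\<bar>measure (law (\<theta> n)) {..<t n} - ?v * (t n - g (\<theta> n))\<bar> \<le> e * (t n - g (\<theta> n))"
      proof (rule measure_law_lessThan_bounds)
        show "\<theta> n \<in> I" "\<theta>\<^sub>0 + b / real n \<in> I" "t n = g (\<theta>\<^sub>0 + b / real n)"
          using elim by (auto simp: \<theta>_def t_def)
        fix y assume y: "y \<in> Y" "g (\<theta> n) \<le> y" "y \<le> t n"
        have "\<bar>f y (\<theta> n) - f y \<theta>\<^sub>0\<bar> \<le> C * \<bar>\<theta> n - \<theta>\<^sub>0\<bar>"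
          using elim y theta0_in_I by (intro f_lipschitz) (auto simp: \<theta>_def)
        moreover have "\<bar>f y \<theta>\<^sub>0 - ?v\<bar> < e / 2"
          using d(2)[OF y(1)] y elim by (simp add: dist_real_def abs_less_iff)
        ultimately show "\<bar>f y (\<theta> n) - ?v\<bar> \<le> e"
          using elim by linarith
      qed fact
      from mult_left_mono[OF this, of "real n"]
      have "\<bar>real n\<bar> * \<bar>measure (law (\<theta> n)) {..<t n} - ?v * (t n - g (\<theta> n))\<bar> \<le> e * len n"
        by (simp add: len_def mult.left_commute)
      then show ?case
        unfolding abs_mult[symmetric] by (simp add: len_def algebra_simps)
    qed
  qed
  have "(\<lambda>n. real n * measure (law (\<theta> n)) {..<t n} - ?v * len n) \<longlonglongrightarrow> 0"
  proof (rule tendstoI)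
    fix r :: real assume "0 < r"
    let ?L = "(b - h) * Dg \<theta>\<^sub>0 + 1"
    have L: "0 < ?L" using False Dg_pos by (simp add: add_pos_pos)
    have "eventually (\<lambda>n. len n < ?L) sequentially"
      by (rule order_tendstoD(2)[OF len]) simp
    moreover have "eventually (\<lambda>n. \<bar>real n * measure (law (\<theta> n)) {..<t n} - ?v * len n\<bar> \<le> r / ?L * len n) sequentially"
      using L \<open>0 < r\<close> by (intro approx) simp
    ultimately show "eventually (\<lambda>n. dist (real n * measure (law (\<theta> n)) {..<t n} - ?v * len n) 0 < r) sequentially"
    proof eventually_elim
      case (elim n)
      have "r / ?L * len n < r / ?L * ?L"
        using L \<open>0 < r\<close> elim(1) by (intro mult_strict_left_mono) auto
      also have "\<dots> = r" using L by simp
      finally show ?case using elim(2) by (simp add: dist_real_def)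
    qed
  qed
  from tendsto_add[OF this tendsto_mult_left[OF len, of ?v]] show ?thesis
    using False by (simp add: \<theta>_def t_def max_def mult_ac)
qed

lemma survival_tendsto:
  defines "S \<equiv> \<lambda>h b n. measure (law (\<theta>\<^sub>0 + h / real n)) {g (\<theta>\<^sub>0 + b / real n)..}"
  shows "S h b \<longlonglongrightarrow> 1"
    and "(\<lambda>n. S h b n ^ n) \<longlonglongrightarrow> exp (- (max 0 (b - h) * rate))"
proof -
  define p where "p n = measure (law (\<theta>\<^sub>0 + h / real n)) {..<g (\<theta>\<^sub>0 + b / real n)}" for n
  have np: "(\<lambda>n. real n * p n) \<longlonglongrightarrow> max 0 (b - h) * rate"
    unfolding p_def by (rule mass_below_cutoff)
  have S: "eventually (\<lambda>n. 1 - p n = S h b n) sequentially"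
    using eventually_in_Theta[of h]
  proof eventually_elim
    case (elim n)
    interpret prob_space "law (\<theta>\<^sub>0 + h / real n)" by (rule density_prob[OF elim])
    have "UNIV - {..<g (\<theta>\<^sub>0 + b / real n)} = {g (\<theta>\<^sub>0 + b / real n)..}" by auto
    then show ?case
      using prob_compl[of "{..<g (\<theta>\<^sub>0 + b / real n)}"] by (simp add: S_def p_def sets_law)
  qed
  have "(\<lambda>n. inverse (real n) * (real n * p n)) \<longlonglongrightarrow> 0 * (max 0 (b - h) * rate)"
    by (intro tendsto_mult lim_inverse_n np)
  moreover have "eventually (\<lambda>n. inverse (real n) * (real n * p n) = p n) sequentially"
    using eventually_gt_at_top[of 0] by eventually_elim simp
  ultimately have "p \<longlonglongrightarrow> 0"
    by (simp add: tendsto_cong)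
  from tendsto_diff[OF tendsto_const[of 1] this] have "(\<lambda>n. 1 - p n) \<longlonglongrightarrow> 1" by simp
  then show "S h b \<longlonglongrightarrow> 1"
    using S by (rule Lim_transform_eventually)
  show "(\<lambda>n. S h b n ^ n) \<longlonglongrightarrow> exp (- (max 0 (b - h) * rate))"
    using power_tendsto_exp[OF np]
  proof (rule Lim_transform_eventually)
    show "eventually (\<lambda>n. (1 - p n) ^ n = S h b n ^ n) sequentially"
      using S by eventually_elim simp
  qed
qed

section \<open>The interior: distance of local alternatives on the common support\<close>

text \<open>
  The mean value theorem for the square root of the density. The intermediate parameter has its boundary
  below the larger of the two, so the information integrand at that parameter is present wherever both
  densities are positive.
\<close>

lemma sqrt_density_increment:
  assumes y: "y \<in> Y" and "s \<in> I" "t \<in> I"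
  obtains \<xi> where "\<xi> \<in> I" "g \<xi> \<le> max (g s) (g t)"
    "(sqrt (f y s) - sqrt (f y t))\<^sup>2 = (s - t)\<^sup>2 * ((Df y \<xi>)\<^sup>2 / (4 * f y \<xi>))"
proof -
  have *: "\<exists>\<xi>\<in>I. g \<xi> \<le> g t
      \<and> (sqrt (f y s) - sqrt (f y t))\<^sup>2 = (s - t)\<^sup>2 * ((Df y \<xi>)\<^sup>2 / (4 * f y \<xi>))"
    if st: "s \<in> I" "t \<in> I" "s < t" for s t
  proof -
    have sub: "\<xi> \<in> I" if "s \<le> \<xi>" "\<xi> \<le> t" for \<xi>
      using st that by (auto simp: I_def)
    have "\<exists>\<xi>>s. \<xi> < t \<and> sqrt (f y t) - sqrt (f y s) = (t - s) * (Df y \<xi> / (2 * sqrt (f y \<xi>)))"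
    proof (rule MVT2[OF st(3)])
      fix \<xi> assume "s \<le> \<xi>" "\<xi> \<le> t"
      note \<xi> = f_DERIV[OF y sub[OF this]] f_pos[OF y sub[OF this]]
      show "((\<lambda>t. sqrt (f y t)) has_real_derivative Df y \<xi> / (2 * sqrt (f y \<xi>))) (at \<xi>)"
        using \<xi> by (auto intro!: derivative_eq_intros simp: divide_simps)
    qed
    then obtain \<xi> where \<xi>: "s < \<xi>" "\<xi> < t"
      and eq: "sqrt (f y t) - sqrt (f y s) = (t - s) * (Df y \<xi> / (2 * sqrt (f y \<xi>)))" by blast
    have "\<xi> \<in> I" using sub \<xi> by simp
    moreover have "(sqrt (f y s) - sqrt (f y t))\<^sup>2 = (sqrt (f y t) - sqrt (f y s))\<^sup>2"
      by (rule power2_commute)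
    then have "(sqrt (f y s) - sqrt (f y t))\<^sup>2 = (s - t)\<^sup>2 * ((Df y \<xi>)\<^sup>2 / (4 * f y \<xi>))"
      unfolding eq using f_pos[OF y \<open>\<xi> \<in> I\<close>]
      by (simp add: power_mult_distrib power_divide power2_commute[of s t])
    moreover have "g \<xi> \<le> g t"
      using \<open>\<xi> \<in> I\<close> st \<xi> by (intro strict_mono_on_leD[OF g_mono]) auto
    ultimately show ?thesis by blast
  qed
  consider "s < t" | "t < s" | "s = t" by linarith
  then show ?thesis
  proof cases
    case 1
    from *[OF assms(2,3) this] show ?thesis using that by (auto simp: max.coboundedI2)
  next
    case 2
    from *[OF assms(3,2) this] show ?thesis
      using that by (auto simp: max.coboundedI1 power2_commute)
  next
    case 3
    then show ?thesis using that[of s] assms by simp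
  qed
qed

text \<open>
  The increment of the square root of the density, divided by \<open>(s - t)\<^sup>2\<close> after squaring, is dominated
  pointwise by the supremum in the information integral.
\<close>

lemma hellinger_bound:
  assumes "s \<in> I" "t \<in> I"
  defines "A \<equiv> {max (g s) (g t)..}"
  shows "(\<integral>y. (sqrt (density_at s y * indicator A y) - sqrt (density_at t y * indicator A y))\<^sup>2 \<partial>lborel)
      \<le> K * (s - t)\<^sup>2" (is "(\<integral>y. ?H y \<partial>lborel) \<le> _")
proof (cases "s = t")
  case False
  define c where "c = (s - t)\<^sup>2"
  have c: "0 < c" using False by (simp add: c_def)
  have [measurable]: "density_at s \<in> borel_measurable borel" "density_at t \<in> borel_measurable borel"
    "A \<in> sets borel"
    using assms I_subset by (auto intro!: density_measurable simp: A_def)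
  \<comment> \<open>the supremum over the parameter need not be measurable, so the constant is moved to the other side\<close>
  have "(\<integral>\<^sup>+y. ennreal (?H y) \<partial>lborel) = (\<integral>\<^sup>+y. ennreal c * ennreal (?H y / c) \<partial>lborel)"
  proof (rule nn_integral_cong)
    fix y :: real
    have "ennreal (?H y) = ennreal (c * (?H y / c))" using c by simp
    also have "\<dots> = ennreal c * ennreal (?H y / c)" using c by (intro ennreal_mult) auto
    finally show "ennreal (?H y) = ennreal c * ennreal (?H y / c)" .
  qed
  also have "\<dots> = ennreal c * (\<integral>\<^sup>+y. ennreal (?H y / c) \<partial>lborel)"
    by (rule nn_integral_cmult) measurable
  also have "\<dots> \<le> ennreal c * ennreal K"
  proof (rule mult_left_mono)
    have "(\<integral>\<^sup>+y. ennreal (?H y / c) \<partial>lborel)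
        \<le> (\<integral>\<^sup>+y\<in>Y. (SUP \<theta>\<in>I. ennreal ((Df y \<theta>)\<^sup>2 / f y \<theta> * indicator {g \<theta>..} y)) \<partial>lborel)"
    proof (rule nn_integral_mono)
      fix y :: real
      show "ennreal (?H y / c)
        \<le> (SUP \<theta>\<in>I. ennreal ((Df y \<theta>)\<^sup>2 / f y \<theta> * indicator {g \<theta>..} y)) * indicator Y y"
      proof (cases "y \<in> Y \<and> y \<in> A")
        case True
        then obtain \<xi> where \<xi>: "\<xi> \<in> I" "g \<xi> \<le> max (g s) (g t)"
          and eq: "(sqrt (f y s) - sqrt (f y t))\<^sup>2 = (s - t)\<^sup>2 * ((Df y \<xi>)\<^sup>2 / (4 * f y \<xi>))"
          using sqrt_density_increment[of y s t] assms by blast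
        have "?H y / c = (Df y \<xi>)\<^sup>2 / (4 * f y \<xi>)"
        proof -
          have "?H y = (sqrt (f y s) - sqrt (f y t))\<^sup>2"
            using True by (simp add: obs_density_def A_def)
          then show ?thesis unfolding eq c_def[symmetric] using c by simp
        qed
        also have "\<dots> \<le> (Df y \<xi>)\<^sup>2 / f y \<xi> * indicator {g \<xi>..} y"
        proof -
          have "max (g s) (g t) \<le> y" using True by (simp add: A_def)
          with \<xi>(2) have "y \<in> {g \<xi>..}" by (auto dest: order_trans)
          then show ?thesis
            using True \<xi> f_pos[of y \<xi>] by (simp add: divide_left_mono)
        qed
        finally have "ennreal (?H y / c) \<le> ennreal ((Df y \<xi>)\<^sup>2 / f y \<xi> * indicator {g \<xi>..} y)"
          by (rule ennreal_leI)
        also have "\<dots> \<le> (SUP \<theta>\<in>I. ennreal ((Df y \<theta>)\<^sup>2 / f y \<theta> * indicator {g \<theta>..} y))"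
          using \<xi> by (intro SUP_upper)
        finally show ?thesis using True by simp
      next
        case False
        then have H0: "?H y = 0" by (auto simp: obs_density_def)
        show ?thesis by (simp only: H0) simp
      qed
    qed
    also have "\<dots> \<le> ennreal K" by (rule information)
    finally show "(\<integral>\<^sup>+y. ennreal (?H y / c) \<partial>lborel) \<le> ennreal K" .
  qed simp
  also have "ennreal c * ennreal K = ennreal (K * (s - t)\<^sup>2)"
    unfolding c_def using K_nonneg by (simp add: mult.commute ennreal_mult)
  finally have "(\<integral>\<^sup>+y. ennreal (?H y) \<partial>lborel) \<le> ennreal (K * (s - t)\<^sup>2)" .
  then have "enn2real (\<integral>\<^sup>+y. ennreal (?H y) \<partial>lborel) \<le> K * (s - t)\<^sup>2"
    using K_nonneg by (intro enn2real_leI) auto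
  then show ?thesis
    by (subst integral_eq_nn_integral) auto
qed simp

text \<open>
  The finite-sample form of the optimality argument. The sample leaves the common support with probability
  \<open>1 - b ^ n\<close>, and there the test is bounded by one. On the common support the power is compared with the
  power under the null by \<open>product_test_hellinger_bound\<close>. The thresholds in \<open>a\<close> and \<open>b\<close> are the boundary of
  the respective other parameter, because each law already lives above its own boundary.
\<close>

lemma test_power_bound:
  assumes \<theta>: "\<theta> \<in> I" and \<psi>: "\<psi> \<in> borel_measurable (PiM {1..n} (\<lambda>_. borel))"
    and \<psi>01: "\<And>y. y \<in> space (PiM {1..n} (\<lambda>_. borel)) \<Longrightarrow> \<psi> y \<in> {0..1}"
    and \<epsilon>: "0 < \<epsilon>"
    and a: "a = measure (law \<theta>\<^sub>0) {g \<theta>..}" "0 < a"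
    and b: "b = measure (law \<theta>) {g \<theta>\<^sub>0..}" "0 < b"
  shows "(\<integral>y. \<psi> y \<partial>sample_law Y f g \<theta> n) \<le> 1 - b ^ n
     + ((1 + \<epsilon>) * (b / a) ^ n * (\<integral>y. \<psi> y \<partial>sample_law Y f g \<theta>\<^sub>0 n)
       + (1 + 1 / \<epsilon>) * (b ^ n * (real n * (K * (\<theta> - \<theta>\<^sub>0)\<^sup>2) / sqrt (a * b))))"
proof -
  interpret PM: product_sigma_finite "\<lambda>_::nat. lborel :: real measure" by standard
  let ?PM = "PiM {1..n} (\<lambda>_. lborel :: real measure)"
  have Th: "\<theta> \<in> \<Theta>" "\<theta>\<^sub>0 \<in> \<Theta>" using \<theta> theta0_in_I I_subset by auto
  have [measurable]: "density_at \<theta> \<in> borel_measurable borel" "density_at \<theta>\<^sub>0 \<in> borel_measurable borel"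
    using Th by (auto intro: density_measurable)
  have eqM: "(borel_measurable ?PM :: ((nat \<Rightarrow> real) \<Rightarrow> real) set) = borel_measurable (PiM {1..n} (\<lambda>_. borel))"
    by (intro measurable_cong_sets sets_PiM_cong) auto
  have \<psi>L[measurable]: "\<psi> \<in> borel_measurable ?PM"
    using \<psi> by (simp only: eqM)
  have \<psi>L01: "\<psi> y \<in> {0..1}" if "y \<in> space ?PM" for y
    using that \<psi>01[of y] by (simp add: space_PiM)
  define A where "A = {max (g \<theta>) (g \<theta>\<^sub>0)..}"
  have [measurable]: "A \<in> sets borel" by (simp add: A_def)
  define p q where "p y = density_at \<theta>\<^sub>0 y * indicator A y"
    and "q y = density_at \<theta> y * indicator A y" for y
  have p: "integrable lborel p" "\<And>y. 0 \<le> p y" "\<And>y. p y \<le> density_at \<theta>\<^sub>0 y"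
    and q: "integrable lborel q" "\<And>y. 0 \<le> q y" "\<And>y. q y \<le> density_at \<theta> y"
    using Th integrable_real_mult_indicator[OF _ density_integrable(1)[OF Th(1)], of A]
      integrable_real_mult_indicator[OF _ density_integrable(1)[OF Th(2)], of A] density_at_nonneg
    by (auto simp: p_def[abs_def] q_def[abs_def] indicator_def)
  have a': "a = (\<integral>y. p y \<partial>lborel)"
    using measure_law_atLeast_support(1)[OF Th(2), of "g \<theta>"] Th by (simp add: a p_def A_def measure_law)
  have b': "b = (\<integral>y. q y \<partial>lborel)"
    using measure_law_atLeast_support(2)[OF Th(1), of "g \<theta>\<^sub>0"] Th by (simp add: b q_def A_def measure_law)
  define D0 D P Q where "D0 y = (\<Prod>i\<in>{1..n}. density_at \<theta>\<^sub>0 (y i))"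
    and "D y = (\<Prod>i\<in>{1..n}. density_at \<theta> (y i))"
    and "P y = (\<Prod>i\<in>{1..n}. p (y i))" and "Q y = (\<Prod>i\<in>{1..n}. q (y i))" for y :: "nat \<Rightarrow> real"
  have ints: "integrable ?PM D0" "integrable ?PM D" "integrable ?PM P" "integrable ?PM Q"
    unfolding D0_def D_def P_def Q_def using p(1) q(1) density_integrable(1) Th
    by (auto intro!: PM.product_integrable_prod)
  have vals: "(\<integral>y. D y \<partial>?PM) = 1" "(\<integral>y. Q y \<partial>?PM) = b ^ n"
    using PM.product_integral_prod[of "{1..n}" "\<lambda>_. density_at \<theta>"]
      PM.product_integral_prod[of "{1..n}" "\<lambda>_. q"] density_integrable[OF Th(1)] q(1)
    by (simp_all add: D_def Q_def b')
  have le: "0 \<le> P y" "P y \<le> D0 y" "0 \<le> Q y" "Q y \<le> D y" for y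
    unfolding D0_def D_def P_def Q_def using p q by (auto intro!: prod_nonneg prod_mono)
  have bdd: "integrable ?PM (\<lambda>x. \<psi> x * F x)" if "integrable ?PM F" for F :: "(nat \<Rightarrow> real) \<Rightarrow> real"
    using that
  proof (rule Bochner_Integration.integrable_bound)
    show "AE x in ?PM. norm (\<psi> x * F x) \<le> norm (F x)"
      using \<psi>L01 by (intro AE_I2) (auto simp: abs_mult mult_left_le_one_le)
    show "(\<lambda>x. \<psi> x * F x) \<in> borel_measurable ?PM"
      using that by measurable
  qed
  have "(\<integral>y. \<psi> y \<partial>sample_law Y f g \<theta> n) = (\<integral>y. \<psi> y * D y \<partial>?PM)"
    unfolding D_def by (rule integral_sample_law[OF Th(1) \<psi>])
  also have "\<dots> \<le> (\<integral>y. (D y - Q y) + \<psi> y * Q y \<partial>?PM)"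
  proof (rule integral_mono)
    fix y assume "y \<in> space ?PM"
    then have "\<psi> y * (D y - Q y) \<le> D y - Q y"
      using \<psi>L01[of y] le[of y] by (intro mult_left_le_one_le) auto
    then show "\<psi> y * D y \<le> (D y - Q y) + \<psi> y * Q y"
      by (simp add: algebra_simps)
  qed (use ints bdd[OF ints(2)] bdd[OF ints(4)] in auto)
  also have "\<dots> = 1 - b ^ n + (\<integral>y. \<psi> y * Q y \<partial>?PM)"
    using ints bdd[OF ints(4)] vals by (simp del: One_nat_def)
  finally have split: "(\<integral>y. \<psi> y \<partial>sample_law Y f g \<theta> n) \<le> 1 - b ^ n + (\<integral>y. \<psi> y * Q y \<partial>?PM)" .
  have "(\<integral>y. \<psi> y * Q y \<partial>?PM) \<le> (1 + \<epsilon>) * (b / a) ^ n * (\<integral>y. \<psi> y * P y \<partial>?PM)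
       + (1 + 1 / \<epsilon>) * (b ^ n * (real n * (\<integral>y. (sqrt (q y) - sqrt (p y))\<^sup>2 \<partial>lborel) / sqrt (a * b)))"
  proof -
    have "card {1..n} = n" by simp
    moreover have "(\<integral>y. \<psi> y * Q y \<partial>?PM)
      \<le> (1 + \<epsilon>) * (b / a) ^ card {1..n} * (\<integral>y. \<psi> y * P y \<partial>?PM)
       + (1 + 1 / \<epsilon>) * (b ^ card {1..n} * (card {1..n} * (\<integral>y. (sqrt (q y) - sqrt (p y))\<^sup>2 \<partial>lborel) / sqrt (a * b)))"
      unfolding P_def Q_def
      by (rule product_test_hellinger_bound[OF lborel.sigma_finite_measure_axioms finite_atLeastAtMost
            p(1,2) q(1,2) a' a(2) b' b(2) \<psi>L \<psi>L01 \<epsilon>])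
    ultimately show ?thesis by (simp only:)
  qed
  also have "\<dots> \<le> (1 + \<epsilon>) * (b / a) ^ n * (\<integral>y. \<psi> y \<partial>sample_law Y f g \<theta>\<^sub>0 n)
       + (1 + 1 / \<epsilon>) * (b ^ n * (real n * (K * (\<theta> - \<theta>\<^sub>0)\<^sup>2) / sqrt (a * b)))"
  proof (intro add_mono)
    have "(\<integral>y. \<psi> y * P y \<partial>?PM) \<le> (\<integral>y. \<psi> y * D0 y \<partial>?PM)"
      using \<psi>L01 le by (intro integral_mono bdd ints mult_left_mono) auto
    also have "\<dots> = (\<integral>y. \<psi> y \<partial>sample_law Y f g \<theta>\<^sub>0 n)"
      unfolding D0_def by (rule integral_sample_law[OF Th(2) \<psi>, symmetric])
    finally show "(1 + \<epsilon>) * (b / a) ^ n * (\<integral>y. \<psi> y * P y \<partial>?PM)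
        \<le> (1 + \<epsilon>) * (b / a) ^ n * (\<integral>y. \<psi> y \<partial>sample_law Y f g \<theta>\<^sub>0 n)"
      using \<epsilon> a(2) b(2) by (intro mult_left_mono) auto
    have "(\<integral>y. (sqrt (q y) - sqrt (p y))\<^sup>2 \<partial>lborel) \<le> K * (\<theta> - \<theta>\<^sub>0)\<^sup>2"
      unfolding p_def q_def A_def by (rule hellinger_bound[OF \<theta> theta0_in_I])
    then show "(1 + 1 / \<epsilon>) * (b ^ n * (real n * (\<integral>y. (sqrt (q y) - sqrt (p y))\<^sup>2 \<partial>lborel) / sqrt (a * b)))
        \<le> (1 + 1 / \<epsilon>) * (b ^ n * (real n * (K * (\<theta> - \<theta>\<^sub>0)\<^sup>2) / sqrt (a * b)))"
      using \<epsilon> a(2) b(2) by (intro mult_left_mono divide_right_mono) auto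
  qed
  finally show ?thesis
    by (rule order_trans[OF split add_left_mono])
qed

section \<open>Limiting powers and optimality\<close>

lemma power_min_test_tendsto:
  assumes c: "c = lam * ln (1 / \<alpha>)" "0 \<le> c"
  shows "(\<lambda>n. \<integral>y. min_test g \<theta>\<^sub>0 lam \<alpha> n y \<partial>sample_law Y f g (\<theta>\<^sub>0 + h / real n) n)
     \<longlonglongrightarrow> 1 - exp (- (max 0 (0 - h) * rate)) + exp (- (max 0 (c - h) * rate))"
proof -
  let ?S = "\<lambda>b n. measure (law (\<theta>\<^sub>0 + h / real n)) {g (\<theta>\<^sub>0 + b / real n)..}"
  have lim: "(\<lambda>n. 1 - ?S 0 n ^ n + ?S c n ^ n)
      \<longlonglongrightarrow> 1 - exp (- (max 0 (0 - h) * rate)) + exp (- (max 0 (c - h) * rate))"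
    by (intro tendsto_intros survival_tendsto(2))
  show ?thesis
    using lim
  proof (rule Lim_transform_eventually)
    show "eventually (\<lambda>n. 1 - ?S 0 n ^ n + ?S c n ^ n
        = (\<integral>y. min_test g \<theta>\<^sub>0 lam \<alpha> n y \<partial>sample_law Y f g (\<theta>\<^sub>0 + h / real n) n)) sequentially"
      using eventually_in_Theta[of h] eventually_in_I[of c] eventually_gt_at_top[of 0]
    proof eventually_elim
      case (elim n)
      have t: "g (\<theta>\<^sub>0 + c / real n) = g (\<theta>\<^sub>0 + lam / real n * ln (1 / \<alpha>))"
        by (simp add: c)
      have le: "g \<theta>\<^sub>0 \<le> g (\<theta>\<^sub>0 + c / real n)"
        using elim c(2) theta0_in_I by (intro strict_mono_on_leD[OF g_mono]) auto
      show ?case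
        using expectation_min_test[OF elim(1) elim(3) t le] by simp
    qed
  qed
qed

text \<open>
  The bound of \<open>test_power_bound\<close> converges for each fixed splitting weight \<open>r\<close>, since the Hellinger term is
  of order \<open>1 / n\<close>. The same \<open>r\<close> serves as slack in the level, and letting \<open>r\<close> tend to zero removes both.
\<close>

lemma limsup_power_le:
  assumes test: "is_test_seq \<psi>"
    and level: "asymptotic_level (\<lambda>h n. sample_law Y f g (\<theta>\<^sub>0 + h / real n) n) \<alpha> \<psi>"
  shows "limsup (\<lambda>n. ereal (\<integral>y. \<psi> n y \<partial>sample_law Y f g (\<theta>\<^sub>0 + h / real n) n))
     \<le> ereal (1 - exp (- (max 0 (0 - h) * rate)) + exp (h * rate) * \<alpha>)"
proof -
  let ?E = "\<lambda>h n. \<integral>y. \<psi> n y \<partial>sample_law Y f g (\<theta>\<^sub>0 + h / real n) n"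
  define B where "B = exp (- (max 0 (0 - h) * rate))"
  define U where "U r = 1 - B + (1 + r) * exp (h * rate) * (\<alpha> + r)" for r
  \<comment> \<open>the zero shift is written out so that both sequences are instances of \<open>survival_tendsto\<close>\<close>
  define b a where "b n = measure (law (\<theta>\<^sub>0 + h / real n)) {g (\<theta>\<^sub>0 + 0 / real n)..}"
    and "a n = measure (law (\<theta>\<^sub>0 + 0 / real n)) {g (\<theta>\<^sub>0 + h / real n)..}" for n
  have b: "b \<longlonglongrightarrow> 1" "(\<lambda>n. b n ^ n) \<longlonglongrightarrow> B"
    using survival_tendsto[of h 0] by (simp_all only: b_def[abs_def] B_def)
  have a: "a \<longlonglongrightarrow> 1" "(\<lambda>n. a n ^ n) \<longlonglongrightarrow> exp (- (max 0 (h - 0) * rate))"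
    using survival_tendsto[of 0 h] by (simp_all only: a_def[abs_def])
  have ratio: "(\<lambda>n. (b n / a n) ^ n) \<longlonglongrightarrow> exp (h * rate)"
  proof -
    have "B / exp (- (max 0 (h - 0) * rate)) = exp (h * rate)"
      unfolding B_def exp_diff[symmetric] by (simp add: max_def algebra_simps)
    with tendsto_divide[OF b(2) a(2)] show ?thesis by (simp add: power_divide)
  qed
  have hell: "(\<lambda>n. real n * (K * (\<theta>\<^sub>0 + h / real n - \<theta>\<^sub>0)\<^sup>2) / sqrt (a n * b n)) \<longlonglongrightarrow> 0"
  proof -
    have "(\<lambda>n. K * h\<^sup>2 * inverse (real n) / sqrt (a n * b n)) \<longlonglongrightarrow> K * h\<^sup>2 * 0 / sqrt (1 * 1)"
      by (intro tendsto_intros lim_inverse_n a b) simp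
    then have "(\<lambda>n. K * h\<^sup>2 * inverse (real n) / sqrt (a n * b n)) \<longlonglongrightarrow> 0"
      by simp
    moreover have "real n * (K * (\<theta>\<^sub>0 + h / real n - \<theta>\<^sub>0)\<^sup>2) = K * h\<^sup>2 * inverse (real n)" for n
      by (simp add: field_simps power2_eq_square)
    ultimately show ?thesis by (simp only:)
  qed
  have bound: "limsup (\<lambda>n. ereal (?E h n)) \<le> ereal (U r)" if r: "0 < r" for r
  proof -
    let ?X = "\<lambda>n. 1 - b n ^ n + ((1 + r) * (b n / a n) ^ n * (\<alpha> + r)
       + (1 + 1 / r) * (b n ^ n * (real n * (K * (\<theta>\<^sub>0 + h / real n - \<theta>\<^sub>0)\<^sup>2) / sqrt (a n * b n))))"
    have "limsup (\<lambda>n. ereal (?E 0 n)) < ereal (\<alpha> + r)"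
      by (rule le_less_trans[OF level[unfolded asymptotic_level_def]]) (use r in simp)
    then have "eventually (\<lambda>n. ereal (?E 0 n) < ereal (\<alpha> + r)) sequentially"
      by (rule Limsup_lessD)
    moreover have "eventually (\<lambda>n. 0 < a n) sequentially" "eventually (\<lambda>n. 0 < b n) sequentially"
      by (rule order_tendstoD(1)[OF a(1)] order_tendstoD(1)[OF b(1)], simp)+
    ultimately have "eventually (\<lambda>n. ereal (?E h n) \<le> ereal (?X n)) sequentially"
      using eventually_in_I[of h]
    proof eventually_elim
      case (elim n)
      have "?E h n \<le> 1 - b n ^ n + ((1 + r) * (b n / a n) ^ n * (\<integral>y. \<psi> n y \<partial>sample_law Y f g \<theta>\<^sub>0 n)
       + (1 + 1 / r) * (b n ^ n * (real n * (K * (\<theta>\<^sub>0 + h / real n - \<theta>\<^sub>0)\<^sup>2) / sqrt (a n * b n))))"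
        by (rule test_power_bound) (use test elim r in \<open>auto simp: is_test_seq_def a_def b_def\<close>)
      also have "\<dots> \<le> ?X n"
        using elim r by (intro add_mono order_refl mult_left_mono) auto
      finally show ?case by simp
    qed
    then have "limsup (\<lambda>n. ereal (?E h n)) \<le> limsup (\<lambda>n. ereal (?X n))"
      by (rule Limsup_mono)
    also have "?X \<longlonglongrightarrow> 1 - B + ((1 + r) * exp (h * rate) * (\<alpha> + r) + (1 + 1 / r) * (B * 0))"
      by (intro tendsto_intros b ratio hell)
    then have "?X \<longlonglongrightarrow> U r"
      by (simp add: U_def)
    then have "limsup (\<lambda>n. ereal (?X n)) = ereal (U r)"
      by (intro lim_imp_Limsup) auto
    finally show ?thesis .
  qed
  have "(\<lambda>k. U (inverse (real (Suc k)))) \<longlonglongrightarrow> 1 - B + (1 + 0) * exp (h * rate) * (\<alpha> + 0)"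
    unfolding U_def by (intro tendsto_intros LIMSEQ_inverse_real_of_nat)
  then have "(\<lambda>k. ereal (U (inverse (real (Suc k))))) \<longlonglongrightarrow> ereal (1 - B + exp (h * rate) * \<alpha>)"
    by simp
  then have "limsup (\<lambda>n. ereal (?E h n)) \<le> ereal (1 - B + exp (h * rate) * \<alpha>)"
    by (rule LIMSEQ_le_const) (auto intro!: bound)
  then show ?thesis by (simp only: B_def)
qed

lemma limsup_power_le_1:
  assumes test: "is_test_seq \<psi>"
  shows "limsup (\<lambda>n. ereal (\<integral>y. \<psi> n y \<partial>sample_law Y f g (\<theta>\<^sub>0 + h / real n) n)) \<le> 1"
proof (rule Limsup_bounded)
  show "eventually (\<lambda>n. ereal (\<integral>y. \<psi> n y \<partial>sample_law Y f g (\<theta>\<^sub>0 + h / real n) n) \<le> 1) sequentially"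
    using eventually_in_Theta[of h]
  proof eventually_elim
    case (elim n)
    interpret prob_space "sample_law Y f g (\<theta>\<^sub>0 + h / real n) n"
      unfolding sample_law_def using elim by (intro prob_space_PiM density_prob)
    have "space (sample_law Y f g (\<theta>\<^sub>0 + h / real n) n) = space (PiM {1..n} (\<lambda>_. borel))"
      by (simp add: sample_law_def space_PiM)
    then have "AE y in sample_law Y f g (\<theta>\<^sub>0 + h / real n) n. \<psi> n y \<le> 1"
      using test by (intro AE_I2) (auto simp: is_test_seq_def)
    then show ?case
      by (cases "integrable (sample_law Y f g (\<theta>\<^sub>0 + h / real n) n) (\<psi> n)")
        (auto intro: integral_le_const simp: not_integrable_integral_eq one_ereal_def)
  qed
qed

end

lemma is_test_seq_min_test: "is_test_seq (min_test g \<theta>\<^sub>0 lam \<alpha>)"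
  unfolding is_test_seq_def
proof (intro allI conjI ballI)
  fix n :: nat
  have [measurable]: "(\<lambda>y. Min (y ` {1..n})) \<in> borel_measurable (PiM {1..n} (\<lambda>_. borel :: real measure))"
    by (intro borel_measurable_Min) auto
  show "min_test g \<theta>\<^sub>0 lam \<alpha> n \<in> borel_measurable (PiM {1..n} (\<lambda>_. borel))"
    unfolding min_test_def Let_def by measurable
qed (simp add: min_test_def Let_def)

theorem theorem3:
  fixes Y \<Theta> H :: "real set" and \<theta>\<^sub>0 \<alpha> lam :: real
    and f Df DDf :: "real \<Rightarrow> real \<Rightarrow> real" and g Dg :: "real \<Rightarrow> real"
  assumes "0 < \<alpha>" and "\<alpha> < 1"
    and "assumption_A Y \<Theta> \<theta>\<^sub>0 H f Df DDf g Dg"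
    and "lam = inverse (f (g \<theta>\<^sub>0) \<theta>\<^sub>0 * Dg \<theta>\<^sub>0)"
  shows "AUMP (\<lambda>h n. sample_law Y f g (\<theta>\<^sub>0 + h / real n) n) H \<alpha> (min_test g \<theta>\<^sub>0 lam \<alpha>)"
proof -
  obtain I \<delta> C K where "regular_neighbourhood Y \<Theta> \<theta>\<^sub>0 H f Df DDf g Dg I \<delta> C K"
    using assumption_A.obtain_regular_neighbourhood[OF assms(3)] by blast
  then interpret regular_neighbourhood Y \<Theta> \<theta>\<^sub>0 H f Df DDf g Dg I \<delta> C K .
  let ?Q = "\<lambda>h n. sample_law Y f g (\<theta>\<^sub>0 + h / real n) n"
  define c where "c = lam * ln (1 / \<alpha>)"
  have c: "0 < c"
    unfolding c_def assms(4) using assms(1,2)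
    by (intro mult_pos_pos[OF positive_imp_inverse_positive[OF rate_pos]]) simp
  have "inverse r * l * r = l" if "0 < r" for r l :: real
    using that by simp
  from this[OF rate_pos] have "c * rate = ln (1 / \<alpha>)"
    unfolding c_def assms(4) .
  then have c_rate: "exp (- (c * rate)) = \<alpha>"
    using assms(1) by (simp add: ln_div)
  define \<pi> where "\<pi> h = 1 - exp (- (max 0 (0 - h) * rate)) + exp (- (max 0 (c - h) * rate))" for h
  have power: "(\<lambda>n. ereal (\<integral>y. min_test g \<theta>\<^sub>0 lam \<alpha> n y \<partial>?Q h n)) \<longlonglongrightarrow> ereal (\<pi> h)" for h
    using power_min_test_tendsto[OF c_def, of h] c by (simp add: \<pi>_def)
  have "asymptotic_level ?Q \<alpha> (min_test g \<theta>\<^sub>0 lam \<alpha>)"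
    using lim_imp_Limsup[OF _ power[of 0]] c by (simp add: asymptotic_level_def \<pi>_def c_rate)
  moreover have "limsup (\<lambda>n. ereal (\<integral>y. \<psi> n y \<partial>?Q h n))
      \<le> liminf (\<lambda>n. ereal (\<integral>y. min_test g \<theta>\<^sub>0 lam \<alpha> n y \<partial>?Q h n))"
    if \<psi>: "is_test_seq \<psi>" "asymptotic_level ?Q \<alpha> \<psi>" for \<psi> h
  proof -
    \<comment> \<open>for \<open>h < c\<close> the general bound is the limiting power of the test; from \<open>c\<close> on that power is one\<close>
    have "limsup (\<lambda>n. ereal (\<integral>y. \<psi> n y \<partial>?Q h n)) \<le> ereal (\<pi> h)"
    proof (cases "h < c")
      case True
      have "exp (h * rate) * \<alpha> = exp (- ((c - h) * rate))"
        unfolding c_rate[symmetric] exp_add[symmetric] by (simp add: algebra_simps)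
      with limsup_power_le[OF \<psi>, of h] True show ?thesis by (simp add: \<pi>_def)
    next
      case False
      with limsup_power_le_1[OF \<psi>(1), of h] c show ?thesis
        by (simp add: \<pi>_def one_ereal_def)
    qed
    also have "\<dots> = liminf (\<lambda>n. ereal (\<integral>y. min_test g \<theta>\<^sub>0 lam \<alpha> n y \<partial>?Q h n))"
      using lim_imp_Liminf[OF _ power[of h]] by simp
    finally show ?thesis .
  qed
  ultimately show ?thesis
    unfolding AUMP_def using is_test_seq_min_test by blast
qed

end
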